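(* Let $t\geq 5$ be an integer. For every canonical territory $(T,B)$, the graph $T$ is $C_{2t-2}$-free (it has no induced subgraph isomorphic to the cycle on $2t-2$ vertices).
   Context: Graphs are finite and simple. A path $P$ has length equal to its number of edges. A territory is a pair $(T,B)$ where $T$ is a graph and $B$ is an induced cycle in $T$; its perimeter is the length of $B$. Expansion (with respect to the fixed integer $t\geq 5$). Given a territory $(T',B')$, an expansion of it is any territory $(T,B)$ obtained as follows. Choose, for some integer $k\geq 0$, a stable set $\{x_1,\dots,x_k\}$ of vertices of $B'$, and for each $i$ let $x_i^-,x_i^+$ be the two neighbours of $x_i$ in $B'$. Choose $I\subseteq\{1,\dots,k\}$. Build $T$ from $T'$: for each $i$ add a new path $P_i$ of length $2t-6$ with ends $y_i^-,y_i^+$ and middle vertex $y_i$, and add edges $x_i^-y_i^-$, $x_iy_i$, $x_i^+y_i^+$; for each $i\in I$, with $v_i^-,v_i^+$ the neighbours of $y_i$ in $P_i$ ($v_i^-$ on the side of $y_i^-$), add a new path $Q_i$ of length $t-4$ with ends $z_i^-,z_i^+$ and edges $v_i^-z_i^-$, $v_i^+z_i^+$ (all added vertices new and distinct). For $i\notin I$ let $R_i=x_i^-\text{-}y_i^-\text{-}P_i\text{-}y_i^+\text{-}x_i^+$; for $i\in I$ let $R_i$ go $x_i^-,y_i^-$, along $P_i$ to $v_i^-$, then $z_i^-$, along $Q_i$ to $z_i^+$, then $v_i^+$, along $P_i$ to $y_i^+$, then $x_i^+$. Let $B=(B'\setminus\{x_1,\dots,x_k\})\cup R_1\cup\dots\cup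 R_k$ (an induced cycle of $T$). The territories $(T_m,B_m)$, $m\ge 0$: $T_0$ is a $t$-cycle and $B_0=T_0$. For $m\geq1$, with $N=t(t-3)^{m-1}$ and $B_{m-1}=x_1\text{-}\cdots\text{-}x_N\text{-}x_1$, obtain $T_m$ from $T_{m-1}$ by adding a new cycle $B_m$ which is the $(t-4)$-subdivision of an $N$-cycle $x_1'\text{-}\cdots\text{-}x_N'\text{-}x_1'$ (each edge replaced by a path of length $t-3$) and adding the edges $x_ix_i'$, $i=1,\dots,N$. A territory $(T,B)$ is canonical if for some $m\geq 0$ there is an expansion $(T',B')$ of $(T_m,B_m)$ and an isomorphism $f:V(T)\to V(T')$ between $T$ and $T'$ whose restriction to $V(B)$ is an isomorphism between $B$ and $B'$. *)

theory Defs
  imports Main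
begin

record 'a sgraph =
  verts :: "'a set"
  edges :: "'a set set"

definition simple_graph :: "'a sgraph \<Rightarrow> bool" where
  "simple_graph G \<longleftrightarrow> finite (verts G) \<and> (\<forall>e \<in> edges G. e \<subseteq> verts G \<and> card e = 2)"

definition neighbours :: "'a sgraph \<Rightarrow> 'a \<Rightarrow> 'a set" where
  "neighbours G v = {u \<in> verts G. {u, v} \<in> edges G}"

definition stable_set :: "'a sgraph \<Rightarrow> 'a set \<Rightarrow> bool" where
  "stable_set G S \<longleftrightarrow> S \<subseteq> verts G \<and> (\<forall>u \<in> S. \<forall>v \<in> S. {u, v} \<notin> edges G)"

definition induce :: "'a sgraph \<Rightarrow> 'a set \<Rightarrow> 'a sgraph" where
  "induce G S = \<lparr>verts = S, edges = {e \<in> edges G. e \<subseteq> S}\<rparr>"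

definition isomorphism :: "('a \<Rightarrow> 'b) \<Rightarrow> 'a sgraph \<Rightarrow> 'b sgraph \<Rightarrow> bool" where
  "isomorphism f G H \<longleftrightarrow> bij_betw f (verts G) (verts H) \<and>
     (\<forall>u \<in> verts G. \<forall>v \<in> verts G. {u, v} \<in> edges G \<longleftrightarrow> {f u, f v} \<in> edges H)"

definition induced_free :: "'b sgraph \<Rightarrow> 'a sgraph \<Rightarrow> bool" where
  "induced_free H G \<longleftrightarrow> \<not> (\<exists>S f. S \<subseteq> verts G \<and> isomorphism f (induce G S) H)"

text \<open>Paths and cycles are given by lists of distinct vertices in the order of traversal; a path
  with \<open>n\<close> edges is a list of length \<open>n + 1\<close>.\<close>

definition path_edges :: "'a list \<Rightarrow> 'a set set" where
  "path_edges xs = {{xs ! i, xs ! Suc i} | i. Suc i < length xs}"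

definition cycle_of :: "'a list \<Rightarrow> 'a sgraph" where
  "cycle_of xs = \<lparr>verts = set xs, edges = path_edges xs \<union> {{last xs, hd xs}}\<rparr>"

definition is_cycle :: "'a sgraph \<Rightarrow> bool" where
  "is_cycle C \<longleftrightarrow> (\<exists>xs. distinct xs \<and> length xs \<ge> 3 \<and> C = cycle_of xs)"

definition cycle_graph :: "nat \<Rightarrow> nat sgraph" where
  "cycle_graph n = cycle_of [0..<n]"

definition territory :: "'a sgraph \<Rightarrow> 'a sgraph \<Rightarrow> bool" where
  "territory T B \<longleftrightarrow>
     simple_graph T \<and> is_cycle B \<and> verts B \<subseteq> verts T \<and> B = induce T (verts B)"

text \<open>In the list \<open>P i\<close>, of length \<open>2 * t - 5\<close>, the ends \<open>y\<^sub>i\<^sup>-\<close> and \<open>y\<^sub>i\<^sup>+\<close> are the first and the last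
  entry, the middle vertex \<open>y\<^sub>i\<close> has position \<open>t - 3\<close>, and its neighbours \<open>v\<^sub>i\<^sup>-\<close> and \<open>v\<^sub>i\<^sup>+\<close> have
  positions \<open>t - 4\<close> and \<open>t - 2\<close>. The ends \<open>z\<^sub>i\<^sup>-\<close> and \<open>z\<^sub>i\<^sup>+\<close> of \<open>Q i\<close> are its first and last entry.\<close>

definition detour :: "nat \<Rightarrow> nat set \<Rightarrow> (nat \<Rightarrow> 'a) \<Rightarrow> (nat \<Rightarrow> 'a) \<Rightarrow>
    (nat \<Rightarrow> 'a list) \<Rightarrow> (nat \<Rightarrow> 'a list) \<Rightarrow> nat \<Rightarrow> 'a list" where
  "detour t I xm xp P Q i =
     (if i \<in> I then xm i # take (t - 3) (P i) @ Q i @ drop (t - 2) (P i) @ [xp i]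
      else xm i # P i @ [xp i])"

definition expansion ::
    "nat \<Rightarrow> 'a sgraph \<Rightarrow> 'a sgraph \<Rightarrow> 'a sgraph \<Rightarrow> 'a sgraph \<Rightarrow> bool" where
  "expansion t T' B' T B \<longleftrightarrow> territory T' B' \<and> territory T B \<and>
   (\<exists>(k::nat) x xm xp I P Q.
      inj_on x {1..k} \<and> x ` {1..k} \<subseteq> verts B' \<and> stable_set T' (x ` {1..k}) \<and>
      (\<forall>i \<in> {1..k}. xm i \<noteq> xp i \<and> neighbours B' (x i) = {xm i, xp i}) \<and>
      I \<subseteq> {1..k} \<and>
      (\<forall>i \<in> {1..k}. length (P i) = 2 * t - 5 \<and> distinct (P i) \<and> set (P i) \<inter> verts T' = {}) \<and>
      (\<forall>i \<in> I. length (Q i) = t - 3 \<and> distinct (Q i) \<and> set (Q i) \<inter> verts T' = {}) \<and>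
      (\<forall>i \<in> {1..k}. \<forall>j \<in> {1..k}. i \<noteq> j \<longrightarrow> set (P i) \<inter> set (P j) = {}) \<and>
      (\<forall>i \<in> I. \<forall>j \<in> I. i \<noteq> j \<longrightarrow> set (Q i) \<inter> set (Q j) = {}) \<and>
      (\<forall>i \<in> {1..k}. \<forall>j \<in> I. set (P i) \<inter> set (Q j) = {}) \<and>
      T = \<lparr>verts = verts T' \<union> (\<Union>i \<in> {1..k}. set (P i)) \<union> (\<Union>i \<in> I. set (Q i)),
           edges = edges T' \<union>
             (\<Union>i \<in> {1..k}. path_edges (P i) \<union>
                {{xm i, hd (P i)}, {x i, P i ! (t - 3)}, {xp i, last (P i)}}) \<union>
             (\<Union>i \<in> I. path_edges (Q i) \<union>
                {{P i ! (t - 4), hd (Q i)}, {P i ! (t - 2), last (Q i)}})\<rparr> \<and>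
      B = \<lparr>verts = (verts B' - x ` {1..k}) \<union> (\<Union>i \<in> {1..k}. set (detour t I xm xp P Q i)),
           edges = {e \<in> edges B'. e \<inter> x ` {1..k} = {}} \<union>
             (\<Union>i \<in> {1..k}. path_edges (detour t I xm xp P Q i))\<rparr>)"

text \<open>The vertices of \<open>B\<^sub>m\<close> are \<open>(m, j)\<close> for \<open>j < t * (t - 3) ^ m\<close>, in cyclic order. Numbering from
  \<open>0\<close>, the vertices of \<open>B\<^sub>m\<^sub>+\<^sub>1\<close> that are not subdivision vertices are those at the multiples of
  \<open>t - 3\<close>, the \<open>i\<close>-th of them being joined to the \<open>i\<close>-th vertex of \<open>B\<^sub>m\<close>.\<close>

definition base_cycle :: "nat \<Rightarrow> nat \<Rightarrow> (nat \<times> nat) sgraph" where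
  "base_cycle t m = cycle_of (map (\<lambda>j. (m, j)) [0..<t * (t - 3) ^ m])"

primrec base_graph :: "nat \<Rightarrow> nat \<Rightarrow> (nat \<times> nat) sgraph" where
  "base_graph t 0 = base_cycle t 0"
| "base_graph t (Suc m) =
     \<lparr>verts = verts (base_graph t m) \<union> verts (base_cycle t (Suc m)),
      edges = edges (base_graph t m) \<union> edges (base_cycle t (Suc m)) \<union>
        {{(m, i), (Suc m, (t - 3) * i)} | i. i < t * (t - 3) ^ m}\<rparr>"

text \<open>The vertex type of \<open>T'\<close> is infinite, hence every expansion of a base territory has an
  isomorphic copy in it.\<close>

definition canonical :: "nat \<Rightarrow> 'a sgraph \<Rightarrow> 'a sgraph \<Rightarrow> bool" where
  "canonical t T B \<longleftrightarrow> territory T B \<and>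
     (\<exists>m (T' :: (nat \<times> nat) sgraph) B' f.
        expansion t (base_graph t m) (base_cycle t m) T' B' \<and>
        isomorphism f T T' \<and> isomorphism f B B')"

end

theory Submission
  imports Defs
begin

text \<open>Put \<open>d = t - 3\<close>. A vertex set spanning an induced cycle is connected and 2-regular, so it
  runs through every vertex of degree two along both of its edges.

  If an induced \<open>(2 t - 2)\<close>-cycle meets some \<open>P\<^sub>i \<union> Q\<^sub>i\<close>, then it either closes up to length \<open>t\<close>,
  or uses \<open>Q\<^sub>i\<close> and becomes too long, or contains all of \<open>P\<^sub>i\<close>. In the last case one further vertex
  remains, which has to be the only common neighbour \<open>x\<^sub>i\<close> of \<open>x\<^sub>i\<^sup>-\<close> and \<open>x\<^sub>i\<^sup>+\<close>, and the edge from
  \<open>x\<^sub>i\<close> to \<open>y\<^sub>i\<close> is a chord.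

  Hence the cycle lies in \<open>T\<^sub>m\<close>. Let \<open>B\<^sub>j\<close> be the outermost base cycle that it meets. It meets \<open>B\<^sub>j\<close> in
  paths consisting of \<open>r\<close> consecutive segments of length \<open>d\<close>, with both ends joined to \<open>B\<^sub>j\<^sub>-\<^sub>1\<close>. If
  \<open>r = 1\<close>, it closes up to length \<open>t\<close>; if \<open>r = 2\<close>, the chord argument applies again; if \<open>r \<ge> 3\<close>,
  it is too long.\<close>

section \<open>Induced cycles as connected 2-regular vertex sets\<close>

text \<open>Only adjacency inside \<open>S\<close> is mentioned, so the axioms carry over between
  graphs that agree on \<open>S\<close> and pull back along isomorphisms. Connectedness says that a
  nonempty part of \<open>S\<close> closed under adjacency is all of \<open>S\<close>; this is how a
  short closed path is shown to exhaust the cycle.\<close>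

locale induced_cycle =
  fixes E :: "'v set set" and S :: "'v set"
  assumes finite_S: "finite S"
    and no_loop: "v \<in> S \<Longrightarrow> {v, v} \<notin> E"
    and degree: "v \<in> S \<Longrightarrow> card {u \<in> S. {u, v} \<in> E} = 2"
    and connected: "D \<subseteq> S \<Longrightarrow> D \<noteq> {} \<Longrightarrow>
      (\<And>u v. v \<in> D \<Longrightarrow> u \<in> S \<Longrightarrow> {u, v} \<in> E \<Longrightarrow> u \<in> D) \<Longrightarrow> D = S"
begin

text \<open>Two known neighbours exhaust the degree; this is how chords are refuted.\<close>

lemma two_neighbours:
  assumes "v \<in> S" "a \<in> S" "b \<in> S" "a \<noteq> b" "{a, v} \<in> E" "{b, v} \<in> E" "c \<in> S" "{c, v} \<in> E"
  shows "c = a \<or> c = b"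
proof -
  have "{a, b} = {u \<in> S. {u, v} \<in> E}"
    using assms degree finite_S by (intro card_subset_eq) auto
  then show ?thesis
    using assms by blast
qed

lemma other_neighbour:
  assumes "v \<in> S"
  obtains u where "u \<in> S" "u \<noteq> a" "{u, v} \<in> E"
proof -
  have "\<not> {u \<in> S. {u, v} \<in> E} \<subseteq> {a}"
  proof
    assume "{u \<in> S. {u, v} \<in> E} \<subseteq> {a}"
    then have "card {u \<in> S. {u, v} \<in> E} \<le> card {a}"
      by (intro card_mono) auto
    then show False
      using degree[OF assms] by simp
  qed
  then show thesis
    using that by blast
qed

lemma forced:
  assumes "v \<in> S" "\<And>u. u \<in> S \<Longrightarrow> {u, v} \<in> E \<Longrightarrow> u = a \<or> u = b"
  shows "a \<in> S" "b \<in> S"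
  using other_neighbour[OF assms(1), of a] other_neighbour[OF assms(1), of b] assms(2) by metis+

text \<open>Strictly between \<open>a\<close> and \<open>b\<close> a vertex of \<open>S\<close> can
  use only the two adjacent positions, so by degree two it uses both, and membership spreads in both
  directions up to the endpoints. Taking \<open>p\<close> as a function on indices covers both lists
  and cyclic coordinates.\<close>

lemma run:
  assumes nbr: "\<And>k u. a < k \<Longrightarrow> k < b \<Longrightarrow> u \<in> S \<Longrightarrow> {u, p k} \<in> E \<Longrightarrow> u = p (k - 1) \<or> u = p (Suc k)"
    and c: "a < c" "c < b" "p c \<in> S"
    and k: "a \<le> k" "k \<le> b"
  shows "p k \<in> S"
proof -
  have adjacent: "p (k - 1) \<in> S" "p (Suc k) \<in> S" if "a < k" "k < b" "p k \<in> S" for k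
    using forced[OF that(3) nbr[OF that(1,2)]] by auto
  show ?thesis
  proof (cases "c \<le> k")
    case True
    then have "k \<le> b \<longrightarrow> p k \<in> S"
      by (induction k rule: dec_induct) (use c adjacent in auto)
    then show ?thesis
      using k by simp
  next
    case False
    then have "k \<le> c"
      by simp
    then have "a \<le> k \<longrightarrow> p k \<in> S"
    proof (induction k rule: inc_induct)
      case (step n)
      then show ?case
        using \<open>c < b\<close> adjacent(1)[of "Suc n"] by auto
    qed (use c in auto)
    then show ?thesis
      using k by simp
  qed
qed

abbreviation walk :: "'v list \<Rightarrow> bool" where
  "walk \<equiv> successively (\<lambda>a b. {a, b} \<in> E)"

text \<open>Every vertex of the list already has two neighbours on the list, hence none elsewhere in
  \<open>S\<close>; the list is closed under adjacency and connectedness leaves nothing outside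
  it.\<close>

lemma closed_path:
  assumes "distinct xs" "3 \<le> length xs" "set xs \<subseteq> S" "walk xs" "{last xs, hd xs} \<in> E"
  shows "card S = length xs"
proof -
  let ?n = "length xs"
  have adj: "{xs ! k, xs ! (Suc k mod ?n)} \<in> E" if "k < ?n" for k
  proof (cases "Suc k = ?n")
    case True
    then have "xs ! k = last xs" "xs ! (Suc k mod ?n) = hd xs"
      using assms(2) last_conv_nth[of xs] hd_conv_nth[of xs] by (fastforce simp flip: True)+
    then show ?thesis
      using assms(5) by simp
  next
    case False
    then show ?thesis
      using successively_nth[OF assms(4), of k] that by simp
  qed
  have "u \<in> set xs" if "v \<in> set xs" "u \<in> S" "{u, v} \<in> E" for u v
  proof -
    obtain k where k: "k < ?n" "v = xs ! k"
      using \<open>v \<in> set xs\<close> by (metis in_set_conv_nth)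
    \<comment> \<open>Cyclic predecessor and successor of \<open>k\<close>; they differ because the
      list has at least three entries.\<close>
    define l where "l = (if k = 0 then ?n - 1 else k - 1)"
    define m where "m = Suc k mod ?n"
    have l: "l < ?n" "Suc l mod ?n = k" and m: "m < ?n" and "l \<noteq> m"
      using k assms(2) by (auto simp: l_def m_def mod_Suc split: if_splits)
    have "{xs ! l, v} \<in> E" "{xs ! m, v} \<in> E"
      using adj[OF l(1)] adj[OF k(1)] l k by (auto simp: m_def insert_commute)
    moreover have "xs ! l \<noteq> xs ! m"
      using l m \<open>l \<noteq> m\<close> assms(1) by (simp add: nth_eq_iff_index_eq)
    moreover have "xs ! l \<in> set xs" "xs ! m \<in> set xs"
      using l m by auto
    ultimately show ?thesis
      using two_neighbours[of v "xs ! l" "xs ! m" u] that assms(3) by blast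
  qed
  then have "set xs = S"
    using assms(2,3) by (intro connected) auto
  then show ?thesis
    using distinct_card[OF assms(1)] by simp
qed

text \<open>The first vertex needs a second neighbour. Interior vertices of the path have their
  degree used up by the path, and the last vertex is excluded by hypothesis, so that neighbour is
  new.\<close>

lemma path_extends:
  assumes "distinct xs" "2 \<le> length xs" "set xs \<subseteq> S" "walk xs" "{last xs, hd xs} \<notin> E"
  obtains w where "w \<in> S" "w \<notin> set xs" "{w, hd xs} \<in> E"
proof -
  have "xs \<noteq> []"
    using assms(2) by auto
  have hd: "hd xs = xs ! 0" "hd xs \<in> S"
    using assms(2,3) by (cases xs; simp)+
  obtain w where w: "w \<in> S" "w \<noteq> xs ! 1" "{w, hd xs} \<in> E"
    using other_neighbour[OF hd(2)] by blast
  have "w \<notin> set xs"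
  proof
    assume "w \<in> set xs"
    then obtain i where i: "i < length xs" "w = xs ! i"
      by (metis in_set_conv_nth)
    have "i \<noteq> 0"
      using no_loop[OF hd(2)] w(3) i hd(1) by metis
    moreover have "i \<noteq> 1"
      using w(2) i by auto
    moreover have "i \<noteq> length xs - 1"
    proof
      assume "i = length xs - 1"
      then have "w = last xs"
        using i assms(2) by (subst last_conv_nth) auto
      then show False
        using w(3) assms(5) by simp
    qed
    ultimately have i': "1 < i" "Suc i < length xs"
      using i(1) by auto
    \<comment> \<open>An interior \<open>w\<close> would have three distinct neighbours, at
      \<open>i - 1\<close>, \<open>Suc i\<close> and \<open>0\<close>; \<open>1 < i\<close>
      separates the first from the last.\<close>
    have "{xs ! (i - 1), w} \<in> E" "{xs ! Suc i, w} \<in> E"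
      using successively_nth[OF assms(4), of "i - 1"] successively_nth[OF assms(4), of i] i i'
      by (auto simp: insert_commute)
    moreover have "xs ! (i - 1) \<noteq> xs ! Suc i" "xs ! 0 \<noteq> xs ! (i - 1)" "xs ! 0 \<noteq> xs ! Suc i"
      using i' assms(1) \<open>xs \<noteq> []\<close> by (auto simp: nth_eq_iff_index_eq)
    moreover have "xs ! (i - 1) \<in> S" "xs ! Suc i \<in> S"
      using i' assms(3) by auto
    ultimately show False
      using two_neighbours[of w "xs ! (i - 1)" "xs ! Suc i" "xs ! 0"] w hd
      by (auto simp: insert_commute)
  qed
  then show thesis
    using that w by blast
qed

lemma path_shorter:
  assumes "distinct xs" "2 \<le> length xs" "set xs \<subseteq> S" "walk xs" "{last xs, hd xs} \<notin> E"
  shows "length xs < card S"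
proof -
  obtain w where "w \<in> S" "w \<notin> set xs"
    using path_extends[OF assms] .
  then have "set xs \<subset> S"
    using assms(3) by blast
  then show ?thesis
    using psubset_card_mono[OF finite_S] distinct_card[OF assms(1)] by metis
qed

text \<open>Both ends extend outside the path, the second by reversing the list; with a single
  vertex left over, the two extensions coincide.\<close>

lemma path_closes:
  assumes "distinct xs" "2 \<le> length xs" "set xs \<subseteq> S" "walk xs" "{last xs, hd xs} \<notin> E"
    and "card S = Suc (length xs)"
  obtains w where "w \<in> S" "w \<notin> set xs" "{w, hd xs} \<in> E" "{w, last xs} \<in> E"
proof -
  obtain w where w: "w \<in> S" "w \<notin> set xs" "{w, hd xs} \<in> E"
    using path_extends[OF assms(1-5)] .
  have "walk (rev xs)"
    using assms(4) by (simp add: successively_rev insert_commute)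
  then obtain w' where w': "w' \<in> S" "w' \<notin> set xs" "{w', last xs} \<in> E"
    using path_extends[of "rev xs"] assms
    by (auto simp: last_rev hd_rev insert_commute)
  have "insert w (set xs) = S"
    using w assms finite_S by (intro card_subset_eq) (auto simp: distinct_card)
  then have "w' = w"
    using w' by blast
  then show thesis
    using that w w' by blast
qed

section \<open>Cycles of length \<open>2 * t - 2\<close> avoid an added piece\<close>

text \<open>One piece of an expansion in isolation: \<open>u\<close>, \<open>v\<close>,
  \<open>x\<close> stand for \<open>x_i^-\<close>, \<open>x_i^+\<close>, \<open>x_i\<close>, and
  \<open>h\<close> says that \<open>Q\<close> is present. With \<open>d = t - 3\<close> the cycle
  has \<open>2 * d + 4\<close> vertices. \<open>Q\<close> is excluded first; afterwards the only
  vertex of \<open>P\<close> that can have a neighbour in \<open>S\<close> off the path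
  \<open>u # P @ [v]\<close> is the middle one, namely \<open>x\<close>.\<close>

lemma piece_avoided:
  assumes d: "2 \<le> d" and card: "card S = 2 * d + 4"
    and P: "length P = 2 * d + 1" "distinct P"
    and Q: "h \<Longrightarrow> length Q = d" "h \<Longrightarrow> distinct Q" "h \<Longrightarrow> set P \<inter> set Q = {}"
    and new: "u \<notin> set P" "v \<notin> set P" "x \<notin> set P" "h \<Longrightarrow> u \<notin> set Q" "h \<Longrightarrow> v \<notin> set Q"
    and ends: "u \<noteq> v" "x \<noteq> u" "x \<noteq> v" "{u, v} \<notin> E" "{u, x} \<in> E" "{v, x} \<in> E" "{x, P ! d} \<in> E"
    and walkP: "walk (u # P @ [v])"
    and walkQ: "h \<Longrightarrow> walk (P ! (d - 1) # Q @ [P ! Suc d])"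
    and nbrP: "\<And>k w. 0 < k \<Longrightarrow> k < 2 * d + 2 \<Longrightarrow> {w, (u # P @ [v]) ! k} \<in> E \<Longrightarrow>
        w = (u # P @ [v]) ! (k - 1) \<or> w = (u # P @ [v]) ! Suc k \<or> k = Suc d \<and> w = x \<or>
        h \<and> k = d \<and> w = hd Q \<or> h \<and> k = d + 2 \<and> w = last Q"
    and nbrQ: "\<And>k w. h \<Longrightarrow> 0 < k \<Longrightarrow> k < Suc d \<Longrightarrow>
        {w, (P ! (d - 1) # Q @ [P ! Suc d]) ! k} \<in> E \<Longrightarrow>
        w = (P ! (d - 1) # Q @ [P ! Suc d]) ! (k - 1) \<or> w = (P ! (d - 1) # Q @ [P ! Suc d]) ! Suc k"
    and common: "\<And>w. w \<in> S \<Longrightarrow> {w, u} \<in> E \<Longrightarrow> {w, v} \<in> E \<Longrightarrow> w = x"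
  shows "S \<inter> set P = {}" "h \<Longrightarrow> S \<inter> set Q = {}"
proof -
  \<comment> \<open>Both paths with their attachment points included. Indices shift by one: the
    middle of \<open>P\<close> is \<open>L ! Suc d\<close>, and \<open>M\<close> runs from
    \<open>L ! d\<close> to \<open>L ! (d + 2)\<close>.\<close>
  define L where "L = u # P @ [v]"
  define M where "M = P ! (d - 1) # Q @ [P ! Suc d]"
  have L: "length L = 2 * d + 3" "distinct L" "set L = {u, v} \<union> set P" "hd L = u" "last L = v"
    using P new ends by (auto simp: L_def)
  have L_nth: "L ! Suc k = P ! k" if "k < 2 * d + 1" for k
    using that P by (simp add: L_def nth_append)
  have LE: "{L ! k, L ! Suc k} \<in> E" if "k < 2 * d + 2" for k
    using successively_nth[OF walkP, folded L_def, of k] that L by simp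
  note nbrP' = nbrP[folded L_def]
  show QS: "S \<inter> set Q = {}" if h: h
  proof (rule ccontr)
    note Q = Q[OF h]
    assume "S \<inter> set Q \<noteq> {}"
    then obtain c where c: "c < d" "Q ! c \<in> S"
      using Q(1) by (metis disjoint_iff in_set_conv_nth)
    have M: "length M = d + 2" "M ! Suc c = Q ! c"
      using Q c by (auto simp: M_def nth_append)
    have ME: "{M ! k, M ! Suc k} \<in> E" if "k < Suc d" for k
      using successively_nth[OF walkQ[OF h], folded M_def, of k] that M by simp
    have M_in: "M ! k \<in> S" if "k \<le> Suc d" for k
      by (rule run[of 0 "Suc d" "nth M" "Suc c"]) (use nbrQ[OF h, folded M_def] M c that in auto)
    then have MS: "set M \<subseteq> S"
      using M by (auto simp: in_set_conv_nth)
    have dM: "distinct (P ! d # M)"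
    proof -
      have "P ! k \<notin> set Q" if "k < 2 * d + 1" for k
        using Q(3) P(1) that nth_mem[of k P] by (metis disjoint_iff)
      then show ?thesis
        using Q P d by (auto simp: M_def nth_eq_iff_index_eq)
    qed
    \<comment> \<open>Together with the middle vertex, \<open>M\<close> would close up to a cycle of
      only \<open>d + 3 = t\<close> vertices.\<close>
    have "P ! d \<notin> S"
    proof
      assume "P ! d \<in> S"
      have "{P ! d, M ! 0} \<in> E" "{M ! Suc d, P ! d} \<in> E"
        using LE[of d] LE[of "Suc d"] L_nth[of "d - 1"] L_nth[of d] L_nth[of "Suc d"] d Q(1)
        by (auto simp: M_def nth_append insert_commute)
      then have "card S = length (P ! d # M)"
        using \<open>P ! d \<in> S\<close> MS dM M walkQ[OF h, folded M_def] Q(1)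
        by (intro closed_path) (auto simp: successively_Cons M_def nth_append)
      then show False
        using M card d by simp
    qed
    \<comment> \<open>The detour from \<open>u\<close> to \<open>v\<close> through \<open>Q\<close>.
      With \<open>P ! d\<close> excluded, its inner vertices have no neighbour in \<open>S\<close>
      off it, so all of it lies in \<open>S\<close>.\<close>
    define R where "R = u # take d P @ Q @ drop (Suc d) P @ [v]"
    have R: "length R = 3 * d + 2" "hd R = u" "last R = v"
      using P Q by (auto simp: R_def)
    have dR: "distinct R"
      using P Q new(1-3) new(4,5)[OF h] ends set_take_disj_set_drop_if_distinct[OF P(2), of d "Suc d"]
      by (auto simp: R_def dest: in_set_takeD in_set_dropD)
    \<comment> \<open>\<open>R\<close> follows \<open>L\<close> up to index \<open>d\<close>, then
      \<open>M\<close>, then \<open>L\<close> again; the stretches overlap at \<open>d\<close> and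
      \<open>2 * d + 1\<close>, so both descriptions are available at the junctions.\<close>
    have R1: "R ! k = L ! k" if "k \<le> d" for k
      using that P by (auto simp: R_def L_def nth_append nth_Cons split: nat.splits)
    have R2: "R ! (d + k) = M ! k" if "k \<le> Suc d" for k
      using that P Q d by (auto simp: R_def M_def nth_append nth_Cons split: nat.splits)
    have R3: "R ! (d + k) = L ! Suc k" if "Suc d \<le> k" "k \<le> 2 * d + 1" for k
      using that P Q d
      by (auto simp: R_def L_def nth_append nth_Cons split: nat.splits intro!: arg_cong[where f = "nth P"])
    have nbrR: "w = R ! (k - 1) \<or> w = R ! Suc k"
      if k: "0 < k" "k < 3 * d + 1" and w: "w \<in> S" "{w, R ! k} \<in> E" for k w
    proof -
      have "Q \<noteq> []"
        using d Q(1) by auto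
      then have LQ: "L ! Suc d = P ! d" "hd Q = M ! 1" "last Q = M ! d"
        using d P Q by (auto simp: L_nth M_def nth_append hd_conv_nth last_conv_nth)
      \<comment> \<open>At the junctions \<open>k = d\<close> and \<open>k = d + Suc d\<close> there
        are three candidate neighbours; excluding \<open>P ! d\<close> leaves two.\<close>
      consider "k < d" | "k = d" | "d < k" "k < d + Suc d" | "k = d + Suc d" | "d + Suc d < k"
        by linarith
      then show ?thesis
      proof cases
        case 1
        then show ?thesis
          using nbrP'[of k w] R1[of k] R1[of "k - 1"] R1[of "Suc k"] k w by auto
      next
        case 2
        then show ?thesis
          using nbrP'[of k w] R1[of k] R1[of "k - 1"] R2[of 1] k w LQ \<open>P ! d \<notin> S\<close> by auto
      next
        case 3
        then show ?thesis
          using nbrQ[OF h, folded M_def, of "k - d" w] R2[of "k - d"] R2[of "k - d - 1"]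
            R2[of "Suc (k - d)"] w by auto
      next
        case 4
        then show ?thesis
          using nbrP'[of "d + 2" w] R3[of "d + 1"] R3[of "d + 2"] R2[of d] d w LQ \<open>P ! d \<notin> S\<close>
          by auto
      next
        case 5
        then obtain j where "k = d + Suc j"
          by (metis add.commute add_Suc_right less_imp_Suc_add add.assoc)
        then show ?thesis
          using nbrP'[of "Suc (Suc j)" w] R3[of j] R3[of "Suc j"] R3[of "Suc (Suc j)"] 5 k w
          by auto
      qed
    qed
    have R_in: "R ! k \<in> S" if "k \<le> 3 * d + 1" for k
      by (rule run[of 0 "3 * d + 1" "nth R" "d + Suc c"]) (use nbrR c M that R2[of "Suc c"] in auto)
    have "{R ! k, R ! Suc k} \<in> E" if "k < 3 * d + 1" for k
    proof -
      consider "k < d" | "d \<le> k" "k < d + Suc d" | "d + Suc d \<le> k"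
        by linarith
      then show ?thesis
      proof cases
        case 1
        then show ?thesis
          using R1[of k] R1[of "Suc k"] LE[of k] by simp
      next
        case 2
        then show ?thesis
          using R2[of "k - d"] R2[of "Suc k - d"] ME[of "k - d"] by (simp add: Suc_diff_le)
      next
        case 3
        then show ?thesis
          using R3[of "k - d"] R3[of "Suc k - d"] LE[of "Suc k - d"] that by (simp add: Suc_diff_le)
      qed
    qed
    \<comment> \<open>\<open>R\<close> has non-adjacent ends and \<open>3 * d + 2\<close> vertices,
      but \<open>3 * d + 2 < 2 * d + 4\<close> fails for \<open>2 \<le> d\<close>.\<close>
    then have "length R < card S"
      using R R_in ends dR
      by (intro path_shorter) (auto simp: successively_conv_nth in_set_conv_nth insert_commute less_Suc_eq_le)
    then show False
      using R card d by simp
  qed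
  have nbr: "w = L ! (k - 1) \<or> w = L ! Suc k \<or> k = Suc d \<and> w = x"
    if "0 < k" "k < 2 * d + 2" "w \<in> S" "{w, L ! k} \<in> E" for k w
    using nbrP'[OF that(1,2,4)] QS that(3) Q(1) d
    by (metis disjoint_iff hd_in_set last_in_set length_0_conv not_numeral_le_zero)
  have nbr_off: "w = L ! (k - 1) \<or> w = L ! Suc k"
    if "0 < k" "k < 2 * d + 2" "k \<noteq> Suc d" "w \<in> S" "{w, L ! k} \<in> E" for k w
    using nbr[OF that(1,2,4,5)] that(3) by blast
  \<comment> \<open>The middle vertex may branch to \<open>x\<close>, so a run cannot pass through
    index \<open>Suc d\<close>; the two halves are treated separately.\<close>
  have low: "L ! k \<in> S" if "L ! c \<in> S" "0 < c" "c < Suc d" "k \<le> Suc d" for c k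
    by (rule run[of 0 "Suc d" "nth L" c]) (use nbr_off that in auto)
  have high: "L ! k \<in> S" if "L ! c \<in> S" "Suc d < c" "c < 2 * d + 2" "Suc d \<le> k" "k \<le> 2 * d + 2" for c k
    by (rule run[of "Suc d" "2 * d + 2" "nth L" c]) (use nbr_off that in auto)
  show "S \<inter> set P = {}"
  proof (rule ccontr)
    assume "S \<inter> set P \<noteq> {}"
    then obtain c where c: "c < 2 * d + 1" "L ! Suc c \<in> S"
    proof -
      obtain y where "y \<in> S" "y \<in> set P"
        using \<open>S \<inter> set P \<noteq> {}\<close> by blast
      then show thesis
        using that P(1) L_nth by (metis in_set_conv_nth)
    qed
    have mid: "L ! Suc d \<in> S"
    proof (cases c d rule: linorder_cases)
      case less
      then show ?thesis
        using low[OF c(2), of "Suc d"] by simp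
    next
      case equal
      then show ?thesis
        using c by simp
    next
      case greater
      then show ?thesis
        using high[OF c(2), of "Suc d"] c(1) by simp
    qed
    have nbr_mid: "w = L ! d \<or> w = L ! (d + 2) \<or> w = x" if "w \<in> S" "{w, L ! Suc d} \<in> E" for w
      using nbr[of "Suc d" w] that by auto
    have mid_P: "L ! Suc d = P ! d"
      using L_nth by simp
    \<comment> \<open>Avoiding each of the three candidates in turn shows that at most one of them
      is missing from \<open>S\<close>.\<close>
    have "L ! d \<in> S \<or> L ! (d + 2) \<in> S" "L ! d \<in> S \<or> x \<in> S" "L ! (d + 2) \<in> S \<or> x \<in> S"
      using other_neighbour[OF mid, of x] other_neighbour[OF mid, of "L ! d"]
        other_neighbour[OF mid, of "L ! (d + 2)"] nbr_mid by metis+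
    then consider "L ! d \<in> S" "L ! (d + 2) \<in> S" | "L ! d \<in> S" "x \<in> S" | "L ! (d + 2) \<in> S" "x \<in> S"
      by blast
    then show False
    proof cases
      case 1
      \<comment> \<open>Both halves fill up, giving \<open>2 * d + 3\<close> vertices. The one
        remaining vertex is adjacent to both ends, hence is \<open>x\<close>, whose edge to the
        middle vertex is a chord.\<close>
      have "L ! k \<in> S" if "k < 2 * d + 3" for k
      proof (cases "k \<le> Suc d")
        case True
        then show ?thesis
          using low[OF 1(1), of k] d by simp
      next
        case False
        then show ?thesis
          using high[OF 1(2), of k] that d by simp
      qed
      then have LS: "set L \<subseteq> S"
        using L(1) by (auto simp: in_set_conv_nth)
      then obtain w where w: "w \<in> S" "w \<notin> set L" "{w, u} \<in> E" "{w, v} \<in> E"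
        using path_closes[of L] L walkP[folded L_def] ends card by (auto simp: insert_commute)
      have "{L ! d, L ! Suc d} \<in> E" "{L ! (d + 2), L ! Suc d} \<in> E" "{w, L ! Suc d} \<in> E"
        using LE[of d] LE[of "Suc d"] common[of w] w ends mid_P by (auto simp: insert_commute)
      moreover have "L ! d \<noteq> L ! (d + 2)"
        using L by (simp add: nth_eq_iff_index_eq)
      ultimately have "w = L ! d \<or> w = L ! (d + 2)"
        using two_neighbours[OF mid 1] w by blast
      then show False
        using w(2) L(1) by auto
    next
      case 2
      \<comment> \<open>Half of \<open>L\<close> together with \<open>x\<close> closes up to a cycle
        of \<open>d + 3\<close> vertices; the next case is the mirror image.\<close>
      have walk: "walk (take (d + 2) L)"
        using walkP[folded L_def] by (metis append_take_drop_id successively_append_iff)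
      have "last (take (d + 2) L) = P ! d" "hd (take (d + 2) L) = u"
        using mid_P L d by (auto simp: take_Suc_conv_app_nth hd_append)
      moreover have "set (take (d + 2) L) \<subseteq> S"
        using low[OF 2(1)] d L by (auto simp: in_set_conv_nth)
      moreover have "x \<notin> set (take (d + 2) L)"
        using L new ends by (auto dest: in_set_takeD)
      ultimately have "card S = length (x # take (d + 2) L)"
        using walk L ends 2
        by (intro closed_path) (auto simp: successively_Cons insert_commute)
      then show False
        using L card d by simp
    next
      case 3
      have walk: "walk (drop (Suc d) L)"
        using walkP[folded L_def] by (metis append_take_drop_id successively_append_iff)
      have "hd (drop (Suc d) L) = P ! d" "last (drop (Suc d) L) = v"
        using mid_P L by (auto simp: hd_drop_conv_nth)
      moreover have "set (drop (Suc d) L) \<subseteq> S"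
        using high[OF 3(1)] d L by (auto simp: in_set_conv_nth)
      moreover have "x \<notin> set (drop (Suc d) L)"
        using L new ends by (auto dest: in_set_dropD)
      ultimately have "card S = length (x # drop (Suc d) L)"
        using walk L ends 3
        by (intro closed_path) (auto simp: successively_Cons insert_commute)
      then show False
        using L card d by simp
    qed
  qed
qed

end

section \<open>Cycle graphs and transfer along isomorphisms\<close>

lemma edges_cycle_of:
  assumes "xs \<noteq> []"
  shows "edges (cycle_of xs) = {{xs ! i, xs ! (Suc i mod length xs)} | i. i < length xs}"
proof -
  let ?n = "length xs"
  have "edges (cycle_of xs) = insert {last xs, hd xs} ((\<lambda>i. {xs ! i, xs ! Suc i}) ` {i. Suc i < ?n})"
    by (auto simp: cycle_of_def path_edges_def)
  also have "{last xs, hd xs} = {xs ! (?n - 1), xs ! (Suc (?n - 1) mod ?n)}"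
    using assms by (simp add: last_conv_nth hd_conv_nth)
  also have "(\<lambda>i. {xs ! i, xs ! Suc i}) ` {i. Suc i < ?n} =
      (\<lambda>i. {xs ! i, xs ! (Suc i mod ?n)}) ` {i. Suc i < ?n}"
    by (rule image_cong) auto
  also have "insert {xs ! (?n - 1), xs ! (Suc (?n - 1) mod ?n)} \<dots> =
      (\<lambda>i. {xs ! i, xs ! (Suc i mod ?n)}) ` insert (?n - 1) {i. Suc i < ?n}"
    by simp
  also have "insert (?n - 1) {i. Suc i < ?n} = {i. i < ?n}"
    using assms by (auto simp: less_Suc_eq)
  finally show ?thesis
    by (simp add: setcompr_eq_image)
qed

lemma edges_cycle_graph:
  assumes "0 < n"
  shows "edges (cycle_graph n) = {{i, Suc i mod n} | i. i < n}"
  unfolding cycle_graph_def using assms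
  by (subst edges_cycle_of) (simp, rule Collect_cong, rule ex_cong1, auto)

lemma induced_cycle_cycle_graph:
  assumes n: "3 \<le> n"
  shows "induced_cycle (edges (cycle_graph n)) {..<n}"
proof
  let ?E = "edges (cycle_graph n)"
  have E: "{i, j} \<in> ?E \<longleftrightarrow> j = Suc i mod n \<or> i = Suc j mod n" if "i < n" "j < n" for i j
    using that n by (subst edges_cycle_graph) (auto simp: doubleton_eq_iff)
  show "finite {..<n}"
    by simp
  show "{v, v} \<notin> ?E" if "v \<in> {..<n}" for v
    using that n E[of v v] by (auto simp: mod_Suc)
  show "card {u \<in> {..<n}. {u, v} \<in> ?E} = 2" if "v \<in> {..<n}" for v
  proof -
    have "{u \<in> {..<n}. {u, v} \<in> ?E} = {Suc v mod n, if v = 0 then n - 1 else v - 1}"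
    proof -
      have "{u \<in> {..<n}. {u, v} \<in> ?E} = {u. u < n \<and> (v = Suc u mod n \<or> u = Suc v mod n)}"
        using that by (auto simp: E)
      also have "\<dots> = {Suc v mod n, if v = 0 then n - 1 else v - 1}"
        using that n by (auto simp: mod_Suc split: if_splits)
      finally show ?thesis .
    qed
    then show ?thesis
      using that n by (auto simp: mod_Suc)
  qed
  show "D = {..<n}"
    if D: "D \<subseteq> {..<n}" "D \<noteq> {}" "\<And>u v. v \<in> D \<Longrightarrow> u \<in> {..<n} \<Longrightarrow> {u, v} \<in> ?E \<Longrightarrow> u \<in> D" for D
  proof -
    obtain c where c: "c \<in> D"
      using D by blast
    \<comment> \<open>A set closed under adjacency is closed under rotation by one, so every residue
      is reached from \<open>c\<close>.\<close>
    have rot: "(c + k) mod n \<in> D" for k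
    proof (induction k)
      case 0
      then show ?case
        using c D(1) by auto
    next
      case (Suc k)
      have "{(c + Suc k) mod n, (c + k) mod n} \<in> ?E"
        using n by (subst E) (auto simp: mod_Suc_eq)
      then show ?case
        using D(3)[OF Suc] n by simp
    qed
    have "k \<in> D" if "k < n" for k
      using rot[of "n - c + k"] D(1) c that by auto
    then show ?thesis
      using D(1) by auto
  qed
qed

lemma isomorphism_induced_cycle:
  assumes f: "isomorphism f (induce G S) H" and H: "induced_cycle (edges H) (verts H)"
  shows "induced_cycle (edges G) S" "card S = card (verts H)"
proof -
  interpret H: induced_cycle "edges H" "verts H"
    by fact
  have bij: "bij_betw f S (verts H)"
    and adj: "\<And>u v. u \<in> S \<Longrightarrow> v \<in> S \<Longrightarrow> {u, v} \<in> edges G \<longleftrightarrow> {f u, f v} \<in> edges H"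
    using f by (auto simp: isomorphism_def induce_def)
  show "card S = card (verts H)"
    using bij by (rule bij_betw_same_card)
  have fS: "f u \<in> verts H" if "u \<in> S" for u
    using bij that by (auto simp: bij_betw_def)
  show "induced_cycle (edges G) S"
  proof
    show "finite S"
      using bij H.finite_S bij_betw_finite by blast
    show "{v, v} \<notin> edges G" if "v \<in> S" for v
      using adj[OF that that] H.no_loop[OF fS[OF that]] by simp
    show "card {u \<in> S. {u, v} \<in> edges G} = 2" if "v \<in> S" for v
    proof -
      have "f ` {u \<in> S. {u, v} \<in> edges G} = {u \<in> verts H. {u, f v} \<in> edges H}"
        using adj that by (auto simp: bij_betw_imp_surj_on[OF bij, symmetric])
      moreover have "inj_on f {u \<in> S. {u, v} \<in> edges G}"
        using bij by (auto simp: bij_betw_def inj_on_def)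
      ultimately show ?thesis
        using H.degree[OF fS[OF that]] card_image[of f "{u \<in> S. {u, v} \<in> edges G}"] by simp
    qed
    show "D = S"
      if D: "D \<subseteq> S" "D \<noteq> {}" "\<And>u v. v \<in> D \<Longrightarrow> u \<in> S \<Longrightarrow> {u, v} \<in> edges G \<Longrightarrow> u \<in> D" for D
    proof -
      have "f ` D = verts H"
      proof (rule H.connected)
        show "f ` D \<subseteq> verts H" "f ` D \<noteq> {}"
          using D(1,2) fS by auto
        show "u \<in> f ` D" if uv: "v \<in> f ` D" "u \<in> verts H" "{u, v} \<in> edges H" for u v
        proof -
          obtain v' where v': "v' \<in> D" "v = f v'"
            using uv(1) by auto
          obtain u' where u': "u' \<in> S" "u = f u'"
            using uv(2) bij_betw_imp_surj_on[OF bij] by auto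
          have "{u', v'} \<in> edges G"
            using adj[of u' v'] uv(3) D(1) u' v' by auto
          then show ?thesis
            using D(3)[of v' u'] u' v' by auto
        qed
      qed
      then show ?thesis
        using D(1) bij_betw_imp_surj_on[OF bij] inj_on_image_eq_iff[OF bij_betw_imp_inj_on[OF bij], of D S]
        by simp
    qed
  qed
qed

text \<open>The image under \<open>f\<close> of an induced copy of \<open>H\<close> is again one;
  undoing \<open>f\<close> first gives the isomorphism onto \<open>H\<close>.\<close>

lemma isomorphism_induced_free:
  assumes f: "isomorphism f G G'" and free: "induced_free H G'"
  shows "induced_free H G"
  unfolding induced_free_def
proof
  assume "\<exists>S g. S \<subseteq> verts G \<and> isomorphism g (induce G S) H"
  then obtain S g where S: "S \<subseteq> verts G" and g: "isomorphism g (induce G S) H"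
    by blast
  have bij: "bij_betw f (verts G) (verts G')"
    using f by (simp add: isomorphism_def)
  let ?h = "inv_into (verts G) f"
  have h: "?h (f u) = u" if "u \<in> S" for u
    using that S bij by (intro inv_into_f_f) (auto simp: bij_betw_def)
  have "isomorphism (g \<circ> ?h) (induce G' (f ` S)) H"
    unfolding isomorphism_def
  proof
    have "bij_betw f S (f ` S)"
      using bij S by (rule bij_betw_subset) auto
    then have "bij_betw ?h (f ` S) S"
      using h by (intro bij_betw_byWitness[of _ f]) auto
    moreover have "bij_betw g S (verts H)"
      using g by (simp add: isomorphism_def induce_def)
    ultimately show "bij_betw (g \<circ> ?h) (verts (induce G' (f ` S))) (verts H)"
      by (simp add: induce_def bij_betw_trans)
    have "{f u, f v} \<in> edges G' \<longleftrightarrow> {g u, g v} \<in> edges H" if "u \<in> S" "v \<in> S" for u v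
      using f g S that by (auto simp: isomorphism_def induce_def subset_iff)
    then show "\<forall>u\<in>verts (induce G' (f ` S)). \<forall>v\<in>verts (induce G' (f ` S)).
        {u, v} \<in> edges (induce G' (f ` S)) \<longleftrightarrow> {(g \<circ> ?h) u, (g \<circ> ?h) v} \<in> edges H"
      by (auto simp: induce_def h)
  qed
  moreover have "f ` S \<subseteq> verts G'"
    using S bij by (auto simp: bij_betw_def)
  ultimately show False
    using free by (auto simp: induced_free_def)
qed

section \<open>Cyclic coordinates on the base graphs\<close>

definition level_size :: "nat \<Rightarrow> nat \<Rightarrow> nat" where
  "level_size t l = t * (t - 3) ^ l"

text \<open>The second coordinate is read modulo the length of the \<open>l\<close>-th base cycle, so that stretches
  of the cycle are images of intervals.\<close>

definition level_vertex :: "nat \<Rightarrow> nat \<Rightarrow> nat \<Rightarrow> nat \<times> nat" where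
  "level_vertex t l k = (l, k mod level_size t l)"

lemma level_size_Suc: "level_size t (Suc l) = (t - 3) * level_size t l"
  by (simp add: level_size_def)

lemma level_size_ge:
  assumes "5 \<le> t"
  shows "5 \<le> level_size t l"
proof -
  have "1 \<le> (t - 3) ^ l"
    using assms by (intro one_le_power) simp
  then have "5 * 1 \<le> t * (t - 3) ^ l"
    using assms by (intro mult_le_mono)
  then show ?thesis
    by (simp add: level_size_def)
qed

lemma level_vertex_eq_iff:
  assumes "j \<le> k" "k < j + level_size t l"
  shows "level_vertex t l j = level_vertex t l k \<longleftrightarrow> j = k"
proof
  assume "level_vertex t l j = level_vertex t l k"
  then have "level_size t l dvd k - j"
    using assms mod_eq_dvd_iff_nat[of j k "level_size t l"] by (simp add: level_vertex_def)
  then show "j = k"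
    using assms by (auto dest: dvd_imp_le)
qed simp

text \<open>The factor \<open>t - 3\<close> scales the index and the cycle length alike, so it
  commutes with reduction: the outward spoke depends on the vertex, not on the index chosen for
  it.\<close>

lemma child_level_vertex:
  "level_vertex t (Suc l) ((t - 3) * k) = (Suc l, (t - 3) * snd (level_vertex t l k))"
  by (simp add: level_vertex_def level_size_Suc mod_mult_mult1)

lemma range_mod_nat:
  assumes "0 < n"
  shows "range (\<lambda>k::nat. k mod n) = {i. i < n}"
proof -
  have "i \<in> range (\<lambda>k. k mod n)" if "i < n" for i
    using that by (intro range_eqI[of _ _ i]) simp
  then show ?thesis
    using assms by auto
qed

lemma edges_base_cycle:
  assumes "5 \<le> t"
  shows "edges (base_cycle t m) = {{level_vertex t m k, level_vertex t m (Suc k)} | k. True}"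
proof -
  let ?N = "level_size t m"
  have N: "0 < ?N"
    using level_size_ge[OF assms, of m] by simp
  have "edges (base_cycle t m) = {{(m, i), (m, Suc i mod ?N)} | i. i < ?N}"
    using N unfolding base_cycle_def level_size_def[symmetric]
    by (subst edges_cycle_of) (simp, rule Collect_cong, rule ex_cong1, auto)
  also have "\<dots> = (\<lambda>i. {(m, i), (m, Suc i mod ?N)}) ` range (\<lambda>k. k mod ?N)"
    unfolding range_mod_nat[OF N] by (simp add: setcompr_eq_image)
  also have "\<dots> = {{level_vertex t m k, level_vertex t m (Suc k)} | k. True}"
    by (simp add: image_image full_SetCompr_eq level_vertex_def mod_Suc_eq)
  finally show ?thesis .
qed

lemma verts_base_cycle:
  assumes "5 \<le> t"
  shows "verts (base_cycle t m) = range (level_vertex t m)"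
proof -
  have N: "0 < level_size t m"
    using level_size_ge[OF assms, of m] by simp
  have "(m, i) \<in> range (level_vertex t m)" if "i < level_size t m" for i
    using that by (intro range_eqI[of _ _ i]) (simp add: level_vertex_def)
  then show ?thesis
    using N unfolding base_cycle_def level_size_def[symmetric]
    by (auto simp: cycle_of_def level_vertex_def)
qed

lemma verts_base_graph:
  assumes "5 \<le> t"
  shows "verts (base_graph t m) = (\<Union>l \<le> m. range (level_vertex t l))"
  by (induction m) (auto simp: verts_base_cycle[OF assms] atMost_Suc)

text \<open>The index \<open>k\<close> is unbounded, so each edge is listed many times, but the
  closing edge of a cycle is no longer a special case.\<close>

lemma edges_base_graph:
  assumes "5 \<le> t"
  shows "edges (base_graph t m) =
    {{level_vertex t l k, level_vertex t l (Suc k)} | l k. l \<le> m} \<union>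
    {{level_vertex t l k, level_vertex t (Suc l) ((t - 3) * k)} | l k. l < m}"
proof (induction m)
  case 0
  then show ?case
    by (simp add: edges_base_cycle[OF assms])
next
  case (Suc m)
  have spokes: "{{(m, i), (Suc m, (t - 3) * i)} | i. i < level_size t m} =
      {{level_vertex t m k, level_vertex t (Suc m) ((t - 3) * k)} | k. True}"
  proof -
    have "0 < level_size t m"
      using level_size_ge[OF assms, of m] by simp
    then have "{{(m, i), (Suc m, (t - 3) * i)} | i. i < level_size t m} =
        (\<lambda>i. {(m, i), (Suc m, (t - 3) * i)}) ` range (\<lambda>k. k mod level_size t m)"
      by (simp add: range_mod_nat setcompr_eq_image)
    then show ?thesis
      unfolding child_level_vertex by (simp add: image_image full_SetCompr_eq level_vertex_def)
  qed
  have cycles: "{{level_vertex t l k, level_vertex t l (Suc k)} | l k. l \<le> Suc m} =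
      {{level_vertex t l k, level_vertex t l (Suc k)} | l k. l \<le> m} \<union>
      {{level_vertex t (Suc m) k, level_vertex t (Suc m) (Suc k)} | k. True}"
    unfolding le_Suc_eq by blast
  have spokes': "{{level_vertex t l k, level_vertex t (Suc l) ((t - 3) * k)} | l k. l < Suc m} =
      {{level_vertex t l k, level_vertex t (Suc l) ((t - 3) * k)} | l k. l < m} \<union>
      {{level_vertex t m k, level_vertex t (Suc m) ((t - 3) * k)} | k. True}"
    unfolding less_Suc_eq by blast
  show ?case
    unfolding base_graph.simps sgraph.simps Suc edges_base_cycle[OF assms] cycles spokes'
      spokes[unfolded level_size_def]
    by (simp only: Un_ac)
qed

lemma level_vertex_Suc_iff:
  "level_vertex t l (Suc j) = level_vertex t l (Suc k) \<longleftrightarrow> level_vertex t l j = level_vertex t l k"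
  by (auto simp: level_vertex_def mod_Suc split: if_splits)

lemma level_vertex_child:
  assumes "level_vertex t l j = level_vertex t l k"
  shows "level_vertex t (Suc l) ((t - 3) * j) = level_vertex t (Suc l) ((t - 3) * k)"
  using assms by (simp only: child_level_vertex)

text \<open>\<open>t - 3\<close> divides the length of the outer cycle, so divisibility by it
  survives reduction; cancelling the factor identifies the inner vertices.\<close>

lemma level_vertex_parent:
  assumes "5 \<le> t" "level_vertex t (Suc l) k = level_vertex t (Suc l) ((t - 3) * j)"
  obtains j' where "k = (t - 3) * j'" "level_vertex t l j' = level_vertex t l j"
proof -
  let ?N = "level_size t l"
  have eq: "k mod ((t - 3) * ?N) = (t - 3) * (j mod ?N)"
    using assms(2) by (simp add: level_vertex_def level_size_Suc mod_mult_mult1)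
  moreover have "t - 3 dvd k mod ((t - 3) * ?N) \<longleftrightarrow> t - 3 dvd k"
    by (rule dvd_mod_iff) simp
  ultimately have "t - 3 dvd k"
    by simp
  then obtain j' where j': "k = (t - 3) * j'"
    by blast
  then have "(t - 3) * (j' mod ?N) = (t - 3) * (j mod ?N)"
    using eq by (simp add: mod_mult_mult1)
  then show thesis
    using that[OF j'] assms(1) by (simp add: level_vertex_def)
qed

lemma fst_level_vertex [simp]: "fst (level_vertex t l k) = l"
  by (simp add: level_vertex_def)

lemma level_vertex_level: "level_vertex t l j = level_vertex t l' k \<Longrightarrow> l = l'"
  by (simp add: level_vertex_def)

text \<open>Edges come with arbitrary indices, so each is matched to the given index
  \<open>k\<close>: cycle edges by cancelling \<open>Suc\<close>, spokes by passing to the child or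
  the parent. Positivity makes \<open>k - 1\<close> the true predecessor.\<close>

lemma base_graph_neighbour:
  assumes t: "5 \<le> t" and k: "0 < k" and w: "{w, level_vertex t l k} \<in> edges (base_graph t m)"
  shows "w = level_vertex t l (k - 1) \<or> w = level_vertex t l (Suc k) \<or>
    w = level_vertex t (Suc l) ((t - 3) * k) \<or>
    (\<exists>l' j. l = Suc l' \<and> k = (t - 3) * j \<and> w = level_vertex t l' j)"
proof -
  consider (cycle) l' j where "{w, level_vertex t l k} = {level_vertex t l' j, level_vertex t l' (Suc j)}"
    | (spoke) l' j where
      "{w, level_vertex t l k} = {level_vertex t l' j, level_vertex t (Suc l') ((t - 3) * j)}"
    using w unfolding edges_base_graph[OF t] by blast
  then show ?thesis
  proof cases
    case cycle
    then consider "w = level_vertex t l' j" "level_vertex t l k = level_vertex t l' (Suc j)"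
      | "w = level_vertex t l' (Suc j)" "level_vertex t l k = level_vertex t l' j"
      by (auto simp: doubleton_eq_iff)
    then show ?thesis
    proof cases
      case 1
      then have "l = l'"
        using level_vertex_level by blast
      moreover have "level_vertex t l (k - 1) = level_vertex t l j"
        using 1 k \<open>l = l'\<close> level_vertex_Suc_iff[of t l "k - 1" j] by simp
      ultimately show ?thesis
        using 1 by simp
    next
      case 2
      then have "l = l'"
        using level_vertex_level by blast
      then show ?thesis
        using 2 level_vertex_Suc_iff[of t l k j] by simp
    qed
  next
    case spoke
    then consider "w = level_vertex t l' j" "level_vertex t l k = level_vertex t (Suc l') ((t - 3) * j)"
      | "w = level_vertex t (Suc l') ((t - 3) * j)" "level_vertex t l k = level_vertex t l' j"
      by (auto simp: doubleton_eq_iff)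
    then show ?thesis
    proof cases
      case 1
      then have l: "l = Suc l'"
        using level_vertex_level by blast
      then obtain j' where "k = (t - 3) * j'" "level_vertex t l' j' = level_vertex t l' j"
        using level_vertex_parent[OF t, of l' k j] 1 by metis
      then show ?thesis
        using l 1 by metis
    next
      case 2
      then have "l = l'"
        using level_vertex_level by blast
      then show ?thesis
        using 2 level_vertex_child[of t l k j] by simp
    qed
  qed
qed

text \<open>On its own level a vertex is adjacent only to the next ones, and indices one or three
  apart give different vertices because a level has at least five.\<close>

lemma level_vertex_not_adjacent:
  assumes t: "5 \<le> t" and k: "0 < k"
  shows "{level_vertex t l k, level_vertex t l (k + 2)} \<notin> edges (base_graph t m)"
proof
  assume "{level_vertex t l k, level_vertex t l (k + 2)} \<in> edges (base_graph t m)"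
  then have "level_vertex t l k = level_vertex t l (k + 1) \<or> level_vertex t l k = level_vertex t l (k + 3)"
    using base_graph_neighbour[OF t, of "k + 2" "level_vertex t l k" l m]
    by (auto dest: level_vertex_level simp: numeral_3_eq_3)
  then show False
    using level_vertex_eq_iff[of k "k + 1" t l] level_vertex_eq_iff[of k "k + 3" t l]
      level_size_ge[OF t, of l] by auto
qed

text \<open>Comparing levels, a second common neighbour would be of the same kind for both vertices:
  along the cycle, outward or inward. Each kind forces two indices less than a full turn apart to
  coincide.\<close>

lemma level_vertex_common_neighbour:
  assumes t: "5 \<le> t" and k: "0 < k"
    and w: "{w, level_vertex t l k} \<in> edges (base_graph t m)"
      "{w, level_vertex t l (k + 2)} \<in> edges (base_graph t m)"
  shows "w = level_vertex t l (Suc k)"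
proof (rule ccontr)
  assume ne: "w \<noteq> level_vertex t l (Suc k)"
  note N = level_size_ge[OF t]
  have below: "w = level_vertex t l (k - 1) \<or> w = level_vertex t (Suc l) ((t - 3) * k) \<or>
      (\<exists>l' j. l = Suc l' \<and> k = (t - 3) * j \<and> w = level_vertex t l' j)"
    using base_graph_neighbour[OF t k w(1)] ne by blast
  have above: "w = level_vertex t l (k + 3) \<or> w = level_vertex t (Suc l) ((t - 3) * (k + 2)) \<or>
      (\<exists>l' j. l = Suc l' \<and> k + 2 = (t - 3) * j \<and> w = level_vertex t l' j)"
    using base_graph_neighbour[OF t _ w(2)] ne by (simp add: numeral_3_eq_3)
  \<comment> \<open>The indices are four apart, so five vertices on a level just suffice.\<close>
  have cycle: "level_vertex t l (k - 1) \<noteq> level_vertex t l (k + 3)"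
    using level_vertex_eq_iff[of "k - 1" "k + 3" t l] N[of l] k by simp
  have child: "level_vertex t (Suc l) ((t - 3) * k) \<noteq> level_vertex t (Suc l) ((t - 3) * (k + 2))"
  proof -
    have "(t - 3) * 2 < (t - 3) * level_size t l"
      using N[of l] t by simp
    then have "(t - 3) * (k + 2) < (t - 3) * k + level_size t (Suc l)"
      by (simp add: level_size_Suc algebra_simps)
    then show ?thesis
      using level_vertex_eq_iff[of "(t - 3) * k" "(t - 3) * (k + 2)" t "Suc l"] t by simp
  qed
  have parent: False
    if "l = Suc l'" "k = (t - 3) * j" "k + 2 = (t - 3) * j'" "level_vertex t l' j = level_vertex t l' j'"
    for l' j j'
  proof -
    have "level_vertex t l k = level_vertex t l (k + 2)"
      using level_vertex_child[OF that(4)] that by simp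
    then show False
      using level_vertex_eq_iff[of k "k + 2" t l] N[of l] by simp
  qed
  from below show False
  proof (elim disjE exE conjE)
    assume "w = level_vertex t l (k - 1)"
    then show False
      using above cycle by (auto dest: level_vertex_level)
  next
    assume "w = level_vertex t (Suc l) ((t - 3) * k)"
    then show False
      using above child by (auto dest: level_vertex_level)
  next
    fix l' j
    assume "l = Suc l'" "k = (t - 3) * j" "w = level_vertex t l' j"
    then show False
      using above parent[of l' j] by (auto dest: level_vertex_level)
  qed
qed

section \<open>No induced cycle of length \<open>2 * t - 2\<close> in a base graph\<close>

lemma base_graph_no_cycle:
  assumes t: "5 \<le> t" and cyc: "induced_cycle (edges (base_graph t m)) S"
    and S: "S \<subseteq> verts (base_graph t m)" and card: "card S = 2 * t - 2"
  shows False
proof -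
  interpret induced_cycle "edges (base_graph t m)" S
    by fact
  let ?E = "edges (base_graph t m)"
  define d where "d = t - 3"
  have d: "2 \<le> d" "t = d + 3" and card_d: "card S = 2 * d + 4"
    using t card by (auto simp: d_def)
  note N = level_size_ge[OF t]
  \<comment> \<open>On the outermost level met by \<open>S\<close> no vertex of \<open>S\<close>
    continues outwards, so only cycle edges and inward spokes remain.\<close>
  define top where "top = Max (fst ` S)"
  have "S \<noteq> {}"
    using card t by auto
  then have "top \<in> fst ` S"
    unfolding top_def using finite_S by (intro Max_in) auto
  then obtain v where v: "v \<in> S" "fst v = top"
    by blast
  have le_top: "fst u \<le> top" if "u \<in> S" for u
    unfolding top_def using finite_S that by (intro Max_ge) auto
  have level: "\<exists>k. u = level_vertex t (fst u) k" if "u \<in> S" for u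
    using that S unfolding verts_base_graph[OF t] by force
  have "top \<le> m"
    using v S unfolding verts_base_graph[OF t] by force
  show False
  proof (cases top)
    case 0
    \<comment> \<open>The innermost level has only \<open>t\<close> vertices, fewer than
      \<open>2 * t - 2\<close>.\<close>
    have "S \<subseteq> level_vertex t 0 ` {..<t}"
    proof
      fix u
      assume "u \<in> S"
      then obtain k where "u = level_vertex t 0 k"
        using level[of u] le_top[of u] 0 by auto
      then have "u = level_vertex t 0 (k mod t)"
        by (simp add: level_vertex_def level_size_def)
      then show "u \<in> level_vertex t 0 ` {..<t}"
        using t by auto
    qed
    then have "card S \<le> card (level_vertex t 0 ` {..<t})"
      by (intro card_mono) auto
    also have "\<dots> \<le> t"
      using card_image_le[of "{..<t}" "level_vertex t 0"] by simp
    finally show False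
      using card t by simp
  next
    case (Suc l)
    \<comment> \<open>\<open>A\<close> runs along the outermost level met and \<open>B\<close> along
      the level inside it, with \<open>B k\<close> joined to \<open>A (d * k)\<close>. The paths
      traced below use at most \<open>3 * d + 1\<close> consecutive vertices of \<open>A\<close>,
      well within the window \<open>5 * d\<close> on which \<open>A\<close> is injective.\<close>
    define A where "A = level_vertex t (Suc l)"
    define B where "B = level_vertex t l"
    have size: "level_size t (Suc l) = d * level_size t l" "5 * d \<le> level_size t (Suc l)"
      using N[of l] by (auto simp: level_size_Suc d_def)
    have A_inj: "A j = A k \<longleftrightarrow> j = k" if "j \<le> k" "k < j + 5 * d" for j k
      unfolding A_def using that size(2) by (intro level_vertex_eq_iff) linarith+
    have B_inj: "B j = B k \<longleftrightarrow> j = k" if "j \<le> k" "k < j + 5" for j k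
      using that N[of l] level_vertex_eq_iff[of j k t l] by (simp add: B_def)
    have AB: "A j \<noteq> B k" for j k
      using level_vertex_level[of t "Suc l" j l k] by (auto simp: A_def B_def)
    have nbr: "w = A (k - 1) \<or> w = A (Suc k) \<or> (\<exists>j. k = d * j \<and> w = B j)"
      if "0 < k" "w \<in> S" "{w, A k} \<in> ?E" for k w
    proof -
      have "w \<noteq> level_vertex t (Suc (Suc l)) ((t - 3) * k)"
        using le_top[OF that(2)] Suc by auto
      then show ?thesis
        using base_graph_neighbour[OF t that(1), of w "Suc l" m] that(3)
        by (auto simp: A_def B_def d_def)
    qed
    have EA: "{A k, A (Suc k)} \<in> ?E" for k
      using \<open>top \<le> m\<close> Suc unfolding edges_base_graph[OF t] A_def by blast
    have EB: "{B k, B (Suc k)} \<in> ?E" for k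
      using \<open>top \<le> m\<close> Suc Suc_leD unfolding edges_base_graph[OF t] B_def by blast
    have EAB: "{B k, A (d * k)} \<in> ?E" for k
      using \<open>top \<le> m\<close> Suc Suc_le_lessD unfolding edges_base_graph[OF t] A_def B_def d_def by blast
    have walk_A: "walk (map A [p..<q])" for p q
      using EA by (auto simp: successively_conv_nth)
    have A_list: "walk (map A [p..<p + (n + 1)])" "map A [p..<p + (n + 1)] \<noteq> []"
      "hd (map A [p..<p + (n + 1)]) = A p" "last (map A [p..<p + (n + 1)]) = A (p + n)" for p n
      using walk_A[of p "p + (n + 1)"] by (simp_all add: hd_append hd_map)
    have walk_BA: "walk (B a # map A [d * a..<d * a + (n + 1)])" for a n
      using A_list[of "d * a" n] EAB[of a] by (simp only: successively_Cons) simp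
    have walk_BAB: "walk (B a # map A [d * a..<d * a + (n + 1)] @ [B b])" if "d * b = d * a + n" for a b n
    proof -
      have "{A (d * b), B b} \<in> ?E"
        using EAB[of b] by (simp add: insert_commute)
      then have "walk ((B a # map A [d * a..<d * a + (n + 1)]) @ [B b])"
        using walk_BA[of a n] A_list[of "d * a" n] that
        by (simp only: successively_append_iff last_ConsR) simp
      then show ?thesis
        by simp
    qed
    have distinct_A: "distinct (map A [p..<p + q])" if "q \<le> 5 * d" for p q
    proof -
      have "inj_on A {p..<p + q}"
      proof (rule linorder_inj_onI)
        show "A j \<noteq> A k" if "j < k" "j \<in> {p..<p + q}" "k \<in> {p..<p + q}" for j k
          using A_inj[of j k] that \<open>q \<le> 5 * d\<close> by auto
      qed auto
      then show ?thesis
        by (simp add: distinct_map)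
    qed
    \<comment> \<open>Otherwise \<open>S\<close> would contain \<open>5 * d\<close> vertices, more
      than \<open>2 * d + 4\<close>.\<close>
    have "\<exists>k. A k \<notin> S"
    proof (rule ccontr)
      assume "\<not> (\<exists>k. A k \<notin> S)"
      then have "set (map A [0..<0 + 5 * d]) \<subseteq> S"
        by auto
      then have "card (set (map A [0..<0 + 5 * d])) \<le> card S"
        by (rule card_mono[OF finite_S])
      then show False
        using distinct_card[OF distinct_A[of "5 * d" 0]] card_d d by simp
    qed
    then obtain k0 where k0: "A k0 \<notin> S"
      by blast
    \<comment> \<open>Some stretch of \<open>S\<close> along the level begins after
      \<open>k0\<close>; otherwise absence would propagate from \<open>k0\<close> all the way round
      and reach \<open>v\<close>.\<close>
    have "\<exists>s>k0. A s \<in> S \<and> A (s - 1) \<notin> S"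
    proof (rule ccontr)
      assume no: "\<not> (\<exists>s>k0. A s \<in> S \<and> A (s - 1) \<notin> S)"
      have out: "A (k0 + k) \<notin> S" for k
      proof (induction k)
        case (Suc k)
        then show ?case
          using no[simplified, rule_format, of "k0 + Suc k"] by auto
      qed (use k0 in simp)
      obtain k where "v = A k"
        using level[OF v(1)] v(2) Suc by (auto simp: A_def)
      \<comment> \<open>Adding \<open>k0\<close> full turns lifts the index of \<open>v\<close> to
        at least \<open>k0\<close>.\<close>
      moreover have "A (k0 + (k + k0 * level_size t (Suc l) - k0)) = A k"
      proof -
        have "k0 \<le> k0 * level_size t (Suc l)"
          using N[of "Suc l"] by simp
        then have "k0 + (k + k0 * level_size t (Suc l) - k0) = k + k0 * level_size t (Suc l)"
          by linarith
        then show ?thesis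
          by (simp add: A_def level_vertex_def)
      qed
      ultimately show False
        using out[of "k + k0 * level_size t (Suc l) - k0"] v(1) by simp
    qed
    then obtain s where s: "k0 < s" "A s \<in> S" "A (s - 1) \<notin> S"
      by blast
    \<comment> \<open>Without its predecessor, \<open>A s\<close> needs an inward spoke, so
      \<open>s\<close> is a multiple of \<open>d\<close>.\<close>
    obtain a where a: "s = d * a" "B a \<in> S"
      using other_neighbour[OF s(2), of "A (Suc s)"] nbr[of s] s by (metis gr0I less_nat_zero_code)
    have "0 < a"
      using a s(1) by (cases a) auto
    have start: "A (d * a + 1) \<in> S"
    proof -
      obtain w where w: "w \<in> S" "w \<noteq> B a" "{w, A s} \<in> ?E"
        using other_neighbour[OF s(2), of "B a"] by blast
      have "w = A (Suc s) \<or> (\<exists>j. s = d * j \<and> w = B j)"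
        using nbr[OF _ w(1,3)] s w(1) by auto
      then show ?thesis
        using w a d by auto
    qed
    \<comment> \<open>Strictly between consecutive multiples of \<open>d\<close> there are no inward
      spokes, so a stretch once entered runs to the next multiple.\<close>
    have segment: "A k \<in> S" if "A (d * b + 1) \<in> S" "d * b \<le> k" "k \<le> d * b + d" for b k
    proof (rule run[of "d * b" "d * b + d" A "d * b + 1"])
      show "w = A (j - 1) \<or> w = A (Suc j)"
        if j: "d * b < j" "j < d * b + d" and w: "w \<in> S" "{w, A j} \<in> ?E" for j w
      proof -
        have "j \<noteq> d * i" for i
        proof
          assume "j = d * i"
          then have "d * b < d * i" "d * i < d * Suc b"
            using j by auto
          then show False
            by (simp only: nat_mult_less_cancel_disj) simp
        qed
        then show ?thesis
          using nbr[of j w] j w by auto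
      qed
    qed (use that d in auto)
    \<comment> \<open>If the stretch does not continue past \<open>d * b\<close>, the second
      neighbour there can only be the inward one.\<close>
    have branch: "B b \<in> S" if b: "A (d * b) \<in> S" "A (d * b + 1) \<notin> S" "0 < b" for b
    proof -
      obtain w where w: "w \<in> S" "w \<noteq> A (d * b - 1)" "{w, A (d * b)} \<in> ?E"
        using other_neighbour[OF b(1)] by blast
      have "w = A (Suc (d * b)) \<or> (\<exists>j. d * b = d * j \<and> w = B j)"
        using nbr[OF _ w(1,3)] b d w(2) by auto
      then show ?thesis
        using w b d by auto
    qed
    have run1: "A k \<in> S" if "d * a \<le> k" "k \<le> d * a + d" for k
      using segment[OF start] that by simp
    show False
    proof (cases "A (d * (a + 1) + 1) \<in> S")
      case False
      \<comment> \<open>One segment: the edge between \<open>B a\<close> and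
        \<open>B (Suc a)\<close> closes a cycle of \<open>d + 3 = t\<close> vertices.\<close>
      then have "B (Suc a) \<in> S"
        using branch[of "Suc a"] run1[of "d * Suc a"] by simp
      let ?xs = "B a # map A [d * a..<d * a + (d + 1)] @ [B (Suc a)]"
      have "card S = length ?xs"
      proof (rule closed_path)
        show "distinct ?xs"
          using distinct_A[of "d + 1" "d * a"] AB AB[symmetric] B_inj[of a "Suc a"] d by auto
        show "set ?xs \<subseteq> S"
          using run1 a(2) \<open>B (Suc a) \<in> S\<close> by auto
        show "walk ?xs"
          using walk_BAB[of "Suc a" a d] by simp
        show "{last ?xs, hd ?xs} \<in> ?E"
          using EB[of a] by (simp add: insert_commute)
      qed simp
      then show False
        using card_d d by simp
    next
      case True
      have run2: "A k \<in> S" if "d * a \<le> k" "k \<le> d * a + 2 * d" for k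
        using run1[of k] segment[OF True, of k] that by (cases "k \<le> d * a + d") auto
      show False
      proof (cases "A (d * (a + 2) + 1) \<in> S")
        case False
        \<comment> \<open>Two segments: the path has \<open>2 * d + 3\<close> vertices, and the
          single remaining one is \<open>B (a + 1)\<close>, whose spoke to
          \<open>A (d * a + d)\<close> is a chord.\<close>
        then have "B (a + 2) \<in> S"
          using branch[of "a + 2"] run2[of "d * (a + 2)"] by (simp add: algebra_simps)
        let ?xs = "B a # map A [d * a..<d * a + (2 * d + 1)] @ [B (a + 2)]"
        obtain w where w: "w \<in> S" "{w, hd ?xs} \<in> ?E" "{w, last ?xs} \<in> ?E"
        proof (rule path_closes[of ?xs])
          show "distinct ?xs"
            using distinct_A[of "2 * d + 1" "d * a"] AB AB[symmetric] B_inj[of a "a + 2"] d by auto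
          show "set ?xs \<subseteq> S"
            using run2 a(2) \<open>B (a + 2) \<in> S\<close> by auto
          show "walk ?xs"
            using walk_BAB[of "a + 2" a "2 * d"] by (simp add: algebra_simps)
          show "{last ?xs, hd ?xs} \<notin> ?E"
            using level_vertex_not_adjacent[OF t \<open>0 < a\<close>, of l m] by (simp add: B_def insert_commute)
        qed (use card_d in auto)
        then have "w = B (a + 1)"
          using level_vertex_common_neighbour[OF t \<open>0 < a\<close>, of w l m] by (simp add: B_def)
        define c where "c = d * a + d"
        have c: "A (c - 1) \<in> S" "A c \<in> S" "A (Suc c) \<in> S"
          using run2 d by (auto simp: c_def)
        have "{A (c - 1), A c} \<in> ?E" "{A (Suc c), A c} \<in> ?E" "{w, A c} \<in> ?E"
          using EA[of "c - 1"] EA[of c] EAB[of "a + 1"] d \<open>w = B (a + 1)\<close>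
          by (auto simp: c_def insert_commute algebra_simps)
        moreover have "A (c - 1) \<noteq> A (Suc c)"
          using A_inj[of "c - 1" "Suc c"] d by (auto simp: c_def)
        ultimately have "w = A (c - 1) \<or> w = A (Suc c)"
          using two_neighbours c w(1) by blast
        then show False
          using AB \<open>w = B (a + 1)\<close> by metis
      next
        case True
        \<comment> \<open>Three or more segments: \<open>B a\<close> and the first three already
          form a path of \<open>3 * d + 2\<close> vertices. Its ends are not adjacent, since the
          inward neighbour of the last vertex is \<open>B (a + 3)\<close>, so it should be shorter
          than \<open>2 * d + 4\<close>.\<close>
        have run3: "A k \<in> S" if "d * a \<le> k" "k \<le> d * a + 3 * d" for k
          using run2[of k] segment[OF True, of k] that by (cases "k \<le> d * a + 2 * d") (auto simp: algebra_simps)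
        let ?xs = "B a # map A [d * a..<d * a + (3 * d + 1)]"
        have "length ?xs < card S"
        proof (rule path_shorter)
          show "distinct ?xs"
            using distinct_A[of "3 * d + 1" "d * a"] AB AB[symmetric] d by auto
          show "set ?xs \<subseteq> S"
            using run3 a(2) by auto
          show "walk ?xs"
            using walk_BA[of a "3 * d"] by simp
          show "{last ?xs, hd ?xs} \<notin> ?E"
          proof
            assume "{last ?xs, hd ?xs} \<in> ?E"
            then have "{B a, A (d * (a + 3))} \<in> ?E"
              by (simp add: last_map insert_commute algebra_simps)
            then have "\<exists>j. d * (a + 3) = d * j \<and> B a = B j"
              using nbr[of "d * (a + 3)" "B a"] a(2) AB[symmetric] d by simp
            then show False
              using B_inj[of a "a + 3"] d by auto
          qed
        qed simp
        then show False
          using card_d d by simp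
      qed
    qed
  qed
qed

section \<open>From an expansion back to its base graph\<close>

lemma induced_cycle_cong:
  assumes "induced_cycle E S" "\<And>u v. u \<in> S \<Longrightarrow> v \<in> S \<Longrightarrow> {u, v} \<in> E \<longleftrightarrow> {u, v} \<in> E'"
  shows "induced_cycle E' S"
proof -
  interpret induced_cycle E S
    by fact
  show ?thesis
  proof
    show "{v, v} \<notin> E'" if "v \<in> S" for v
      using no_loop[OF that] assms(2)[OF that that] by simp
    show "card {u \<in> S. {u, v} \<in> E'} = 2" if "v \<in> S" for v
    proof -
      have "{u \<in> S. {u, v} \<in> E'} = {u \<in> S. {u, v} \<in> E}"
        using assms(2) that by auto
      then show ?thesis
        using degree[OF that] by simp
    qed
    show "D = S"
      if D: "D \<subseteq> S" "D \<noteq> {}" "\<And>u v. v \<in> D \<Longrightarrow> u \<in> S \<Longrightarrow> {u, v} \<in> E' \<Longrightarrow> u \<in> D" for D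
      by (rule connected[OF D(1,2)]) (use D(1,3) assms(2) in \<open>metis subsetD\<close>)
  qed (rule finite_S)
qed

lemma path_edges_Cons:
  assumes "xs \<noteq> []"
  shows "path_edges (a # xs) = insert {a, hd xs} (path_edges xs)"
proof -
  obtain y ys where xs: "xs = y # ys"
    using assms by (cases xs) auto
  have "path_edges (a # xs) = (\<lambda>i. {(a # xs) ! i, (a # xs) ! Suc i}) ` {..<Suc (length ys)}"
    by (auto simp: path_edges_def xs)
  also have "\<dots> = insert {a, y} ((\<lambda>i. {xs ! i, xs ! Suc i}) ` {..<length ys})"
    unfolding lessThan_Suc_eq_insert_0 by (simp add: image_image xs)
  also have "(\<lambda>i. {xs ! i, xs ! Suc i}) ` {..<length ys} = path_edges xs"
    by (auto simp: path_edges_def xs)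
  finally show ?thesis
    by (simp add: xs)
qed

lemma path_edges_snoc:
  assumes "xs \<noteq> []"
  shows "path_edges (xs @ [b]) = insert {b, last xs} (path_edges xs)"
  using assms
proof (induction xs rule: list_nonempty_induct)
  case (single x)
  have "path_edges [y] = {}" for y :: 'a
    by (simp add: path_edges_def)
  then show ?case
    by (simp add: path_edges_Cons insert_commute)
next
  case (cons x xs)
  then show ?case
    by (simp add: path_edges_Cons hd_append insert_commute)
qed

text \<open>The inner territory enters through its corners: the two neighbours on \<open>B'\<close>
  of a vertex of \<open>B'\<close> are non-adjacent and have only that vertex in common. The work is
  to read off from the edge set that each piece meets the neighbourhood conditions of
  \<open>piece_avoided\<close>.\<close>

lemma expansion_avoids:
  assumes t: "5 \<le> t" and exp: "expansion t T' B' T B"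
    and cyc: "induced_cycle (edges T) S" and S: "S \<subseteq> verts T" and card: "card S = 2 * t - 2"
    and corner: "\<And>x a b. x \<in> verts B' \<Longrightarrow> neighbours B' x = {a, b} \<Longrightarrow> a \<noteq> b \<Longrightarrow> {a, b} \<notin> edges T'"
    and corner_common: "\<And>x a b w. x \<in> verts B' \<Longrightarrow> neighbours B' x = {a, b} \<Longrightarrow> a \<noteq> b \<Longrightarrow>
      {w, a} \<in> edges T' \<Longrightarrow> {w, b} \<in> edges T' \<Longrightarrow> w = x"
  shows "S \<subseteq> verts T'" "induced_cycle (edges T') S"
proof -
  interpret induced_cycle "edges T" S
    by fact
  define d where "d = t - 3"
  have d: "2 \<le> d" "2 * t - 5 = 2 * d + 1" "t - 4 = d - 1" "t - 2 = Suc d" "t - 3 = d"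
    and card_d: "card S = 2 * d + 4"
    using t card by (auto simp: d_def)
  have terr: "territory T' B'"
    using exp unfolding expansion_def by blast
  obtain k x xm xp I P Q where
    x: "x ` {1..k::nat} \<subseteq> verts B'"
    and nbrs: "\<And>i. i \<in> {1..k} \<Longrightarrow> xm i \<noteq> xp i \<and> neighbours B' (x i) = {xm i, xp i}"
    and I: "I \<subseteq> {1..k}"
    and P: "\<And>i. i \<in> {1..k} \<Longrightarrow> length (P i) = 2 * d + 1 \<and> distinct (P i) \<and> set (P i) \<inter> verts T' = {}"
    and Q: "\<And>i. i \<in> I \<Longrightarrow> length (Q i) = d \<and> distinct (Q i) \<and> set (Q i) \<inter> verts T' = {}"
    and PP: "\<And>i j. i \<in> {1..k} \<Longrightarrow> j \<in> {1..k} \<Longrightarrow> i \<noteq> j \<Longrightarrow> set (P i) \<inter> set (P j) = {}"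
    and QQ: "\<And>i j. i \<in> I \<Longrightarrow> j \<in> I \<Longrightarrow> i \<noteq> j \<Longrightarrow> set (Q i) \<inter> set (Q j) = {}"
    and PQ: "\<And>i j. i \<in> {1..k} \<Longrightarrow> j \<in> I \<Longrightarrow> set (P i) \<inter> set (Q j) = {}"
    and T: "T = \<lparr>verts = verts T' \<union> (\<Union>i \<in> {1..k}. set (P i)) \<union> (\<Union>i \<in> I. set (Q i)),
           edges = edges T' \<union>
             (\<Union>i \<in> {1..k}. path_edges (P i) \<union>
                {{xm i, hd (P i)}, {x i, P i ! d}, {xp i, last (P i)}}) \<union>
             (\<Union>i \<in> I. path_edges (Q i) \<union>
                {{P i ! (d - 1), hd (Q i)}, {P i ! Suc d, last (Q i)}})\<rparr>"
    using exp unfolding expansion_def d by (elim conjE exE) (rule that; simp)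
  define K where "K = {1..k}"
  note x = x[folded K_def] and nbrs = nbrs[folded K_def] and I = I[folded K_def] and P = P[folded K_def]
    and PP = PP[folded K_def] and PQ = PQ[folded K_def] and T = T[folded K_def]
  have edge_sub: "e \<subseteq> verts T'" if "e \<in> edges T'" for e
    using terr that by (auto simp: territory_def simple_graph_def)
  have xB: "x i \<in> verts B'" if "i \<in> K" for i
    using x that by auto
  have B': "verts B' \<subseteq> verts T'" "edges B' \<subseteq> edges T'"
  proof -
    show "verts B' \<subseteq> verts T'"
      using terr by (simp add: territory_def)
    have "edges B' = edges (induce T' (verts B'))"
      using terr by (simp add: territory_def)
    then show "edges B' \<subseteq> edges T'"
      by (auto simp: induce_def)
  qed
  have V: "x i \<in> verts T'" "xm i \<in> verts T'" "xp i \<in> verts T'"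
    and x_edges: "{xm i, x i} \<in> edges T'" "{xp i, x i} \<in> edges T'" if "i \<in> K" for i
  proof -
    have "xm i \<in> neighbours B' (x i)" "xp i \<in> neighbours B' (x i)"
      using nbrs[OF that] by auto
    then show "xm i \<in> verts T'" "xp i \<in> verts T'" "{xm i, x i} \<in> edges T'" "{xp i, x i} \<in> edges T'"
      using B' by (auto simp: neighbours_def)
    show "x i \<in> verts T'"
      using xB[OF that] B' by blast
  qed
  \<comment> \<open>Including the attachment points turns all new edges into path edges, except
    those from \<open>x i\<close> to \<open>P i ! d\<close>.\<close>
  define L where "L i = xm i # P i @ [xp i]" for i
  define M where "M i = P i ! (d - 1) # Q i @ [P i ! Suc d]" for i
  have E: "edges T = edges T' \<union> (\<Union>i\<in>K. insert {x i, P i ! d} (path_edges (L i))) \<union> (\<Union>i\<in>I. path_edges (M i))"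
  proof -
    have "path_edges (L i) = insert {xm i, hd (P i)} (insert {xp i, last (P i)} (path_edges (P i)))"
      if "i \<in> K" for i
    proof -
      have "P i \<noteq> []"
        using P[OF that] by auto
      then show ?thesis
        by (simp add: L_def path_edges_Cons path_edges_snoc)
    qed
    moreover have "path_edges (M i) =
        insert {P i ! (d - 1), hd (Q i)} (insert {P i ! Suc d, last (Q i)} (path_edges (Q i)))"
      if "i \<in> I" for i
    proof -
      have "Q i \<noteq> []"
        using Q[OF that] d by auto
      then show ?thesis
        by (simp add: M_def path_edges_Cons path_edges_snoc)
    qed
    ultimately show ?thesis
      unfolding T by auto
  qed
  have L: "length (L i) = 2 * d + 3" "distinct (L i)" "L i ! 0 = xm i" "L i ! (2 * d + 2) = xp i"
    "\<And>l. l < 2 * d + 1 \<Longrightarrow> L i ! Suc l = P i ! l" if "i \<in> K" for i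
    using P[OF that] V[OF that] nbrs[OF that] by (auto simp: L_def nth_append)
  have L_in: "L i ! l \<in> set (P i)" if "i \<in> K" "0 < l" "l < 2 * d + 2" for i l
    using L(5)[OF that(1), of "l - 1"] P[OF that(1)] that by simp
  have M: "length (M i) = d + 2" "M i ! 0 = P i ! (d - 1)" "M i ! Suc d = P i ! Suc d"
    "M i ! 1 = hd (Q i)" "M i ! d = last (Q i)" "\<And>l. l < d \<Longrightarrow> M i ! Suc l = Q i ! l" if "i \<in> I" for i
  proof -
    have "Q i \<noteq> []"
      using Q[OF that] d by auto
    then show "length (M i) = d + 2" "M i ! 0 = P i ! (d - 1)" "M i ! Suc d = P i ! Suc d"
      "M i ! 1 = hd (Q i)" "M i ! d = last (Q i)" "\<And>l. l < d \<Longrightarrow> M i ! Suc l = Q i ! l"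
      using Q[OF that] d by (auto simp: M_def nth_append hd_conv_nth last_conv_nth)
  qed
  have M_in: "M i ! l \<in> set (Q i)" if "i \<in> I" "0 < l" "l < Suc d" for i l
    using M(6)[OF that(1), of "l - 1"] Q[OF that(1)] that by simp
  \<comment> \<open>Inner vertices of \<open>L i\<close> are new and the pieces are disjoint, so
    such a vertex determines both its piece and its index.\<close>
  have own_L: "j = i \<and> l' = l"
    if "i \<in> K" "j \<in> K" "0 < l" "l < 2 * d + 2" "L i ! l = L j ! l'" "l' < 2 * d + 3" for i j l l'
  proof -
    have "L i ! l \<notin> verts T'"
      using L_in[OF that(1,3,4)] P[OF that(1)] by blast
    then have "l' \<noteq> 0" "l' \<noteq> 2 * d + 2"
      using L(3,4)[OF that(2)] V[OF that(2)] that(5) by metis+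
    then have "L j ! l' \<in> set (P j)"
      using L_in[OF that(2), of l'] that(6) by simp
    then have "j = i"
      using L_in[OF that(1,3,4)] PP[OF that(1,2)] that(5) by auto
    then show ?thesis
      using L(1,2)[OF that(1)] that by (simp add: nth_eq_iff_index_eq)
  qed
  \<comment> \<open>An inner vertex of \<open>L i\<close> can lie on \<open>M j\<close> only as one
    of its two ends, which sit at indices \<open>d\<close> and \<open>d + 2\<close> of
    \<open>L j\<close>.\<close>
  have own_M: "j = i \<and> (l' = 0 \<and> l = d \<or> l' = Suc d \<and> l = d + 2)"
    if "i \<in> K" "j \<in> I" "0 < l" "l < 2 * d + 2" "L i ! l = M j ! l'" "l' < d + 2" for i j l l'
  proof -
    have jK: "j \<in> K"
      using that(2) I by auto
    have "L i ! l \<notin> set (Q j)"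
      using L_in[OF that(1,3,4)] PQ[OF that(1,2)] by blast
    then have "l' = 0 \<or> l' = Suc d"
      using M_in[OF that(2), of l'] that(5,6) by (cases "l' = 0"; cases "l' = Suc d") auto
    then show ?thesis
    proof
      assume "l' = 0"
      then have "L i ! l = L j ! d"
        using M(2)[OF that(2)] L(5)[OF jK, of "d - 1"] that(5) d by simp
      then show ?thesis
        using own_L[OF that(1) jK that(3,4), of d] \<open>l' = 0\<close> by simp
    next
      assume "l' = Suc d"
      then have "L i ! l = L j ! (d + 2)"
        using M(3)[OF that(2)] L(5)[OF jK, of "Suc d"] that(5) d by simp
      then show ?thesis
        using own_L[OF that(1) jK that(3,4), of "d + 2"] \<open>l' = Suc d\<close> d by simp
    qed
  qed
  have edge_cases: thesis
    if e: "e \<in> edges T" "e \<in> edges T' \<Longrightarrow> thesis"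
      "\<And>j l. j \<in> K \<Longrightarrow> l < 2 * d + 2 \<Longrightarrow> e = {L j ! l, L j ! Suc l} \<Longrightarrow> thesis"
      "\<And>j. j \<in> K \<Longrightarrow> e = {x j, L j ! Suc d} \<Longrightarrow> thesis"
      "\<And>j l. j \<in> I \<Longrightarrow> l < Suc d \<Longrightarrow> e = {M j ! l, M j ! Suc l} \<Longrightarrow> thesis" for e thesis
  proof -
    consider "e \<in> edges T'" | j where "j \<in> K" "e = {x j, P j ! d}"
      | j where "j \<in> K" "e \<in> path_edges (L j)" | j where "j \<in> I" "e \<in> path_edges (M j)"
      using e(1) unfolding E by blast
    then show thesis
    proof cases
      case 1
      then show ?thesis
        by (rule e(2))
    next
      case 2
      then show ?thesis
        using e(4)[of j] L(5)[of j d] by simp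
    next
      case 3
      then show ?thesis
        using e(3)[of j] L(1)[of j] by (auto simp: path_edges_def)
    next
      case 4
      then show ?thesis
        using e(5)[of j] M(1)[of j] by (auto simp: path_edges_def)
    qed
  qed
  have nbrP: "w = L i ! (l - 1) \<or> w = L i ! Suc l \<or> l = Suc d \<and> w = x i \<or>
      i \<in> I \<and> l = d \<and> w = hd (Q i) \<or> i \<in> I \<and> l = d + 2 \<and> w = last (Q i)"
    if i: "i \<in> K" and l: "0 < l" "l < 2 * d + 2" and w: "{w, L i ! l} \<in> edges T" for i l w
  proof -
    have new: "L i ! l \<notin> verts T'"
      using L_in[OF i l] P[OF i] by blast
    show ?thesis
    proof (rule edge_cases[OF w])
      assume "{w, L i ! l} \<in> edges T'"
      then show ?thesis
        using edge_sub new by blast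
    next
      fix j l'
      assume j: "j \<in> K" "l' < 2 * d + 2" "{w, L i ! l} = {L j ! l', L j ! Suc l'}"
      then consider "L i ! l = L j ! l'" "w = L j ! Suc l'" | "L i ! l = L j ! Suc l'" "w = L j ! l'"
        unfolding doubleton_eq_iff by metis
      then show ?thesis
      proof cases
        case 1
        then have "j = i \<and> l' = l"
          using own_L[OF i j(1) l 1(1)] j(2) by simp
        then show ?thesis
          using 1(2) by simp
      next
        case 2
        then have "j = i \<and> Suc l' = l"
          using own_L[OF i j(1) l 2(1)] j(2) by simp
        then show ?thesis
          using 2(2) by auto
      qed
    next
      fix j
      assume j: "j \<in> K" "{w, L i ! l} = {x j, L j ! Suc d}"
      moreover have "L i ! l \<noteq> x j"
        using new V(1)[OF j(1)] by metis
      ultimately have "L i ! l = L j ! Suc d" "w = x j"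
        unfolding doubleton_eq_iff by blast+
      then show ?thesis
        using own_L[OF i j(1) l \<open>L i ! l = L j ! Suc d\<close>] by simp
    next
      fix j l'
      assume j: "j \<in> I" "l' < Suc d" "{w, L i ! l} = {M j ! l', M j ! Suc l'}"
      then consider "L i ! l = M j ! l'" "w = M j ! Suc l'" | "L i ! l = M j ! Suc l'" "w = M j ! l'"
        unfolding doubleton_eq_iff by metis
      then show ?thesis
      proof cases
        case 1
        then have "j = i \<and> l' = 0 \<and> l = d"
          using own_M[OF i j(1) l 1(1)] j(2) by auto
        then show ?thesis
          using 1(2) M(4)[OF j(1)] j(1) by simp
      next
        case 2
        then have "j = i \<and> l' = d \<and> l = d + 2"
          using own_M[OF i j(1) l 2(1)] j(2) by auto
        then show ?thesis
          using 2(2) M(5)[OF j(1)] j(1) by simp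
      qed
    qed
  qed
  have nbrQ: "w = M i ! (l - 1) \<or> w = M i ! Suc l"
    if i: "i \<in> I" and l: "0 < l" "l < Suc d" and w: "{w, M i ! l} \<in> edges T" for i l w
  proof -
    have newV: "M i ! l \<notin> verts T'" and newP: "M i ! l \<notin> set (P j)" if "j \<in> K" for j
      using M_in[OF i l] Q[OF i] PQ[OF that i] by blast+
    have iK: "i \<in> K"
      using i I by auto
    have own: "j = i \<and> l' = l" if "j \<in> I" "M i ! l = M j ! l'" "l' < d + 2" for j l'
    proof -
      have jK: "j \<in> K"
        using that(1) I by auto
      have "P j ! (d - 1) \<in> set (P j)" "P j ! Suc d \<in> set (P j)"
        using P[OF jK] d by auto
      then have "l' \<noteq> 0" "l' \<noteq> Suc d"
        using M(2,3)[OF that(1)] newP[OF jK] that(2) by metis+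
      then have l': "0 < l'" "l' < Suc d"
        using that(3) by auto
      then have "j = i"
        using M_in[OF i l] M_in[OF that(1) l'] QQ[OF i that(1)] that(2) by auto
      moreover have "Q i ! (l - 1) = Q i ! (l' - 1)"
        using M(6)[OF i, of "l - 1"] M(6)[OF i, of "l' - 1"] l l' that(2) \<open>j = i\<close> by simp
      ultimately show ?thesis
        using Q[OF i] l l' by (simp add: nth_eq_iff_index_eq)
    qed
    have in_L: "L j ! l' \<in> verts T' \<union> set (P j)" if "j \<in> K" "l' < 2 * d + 3" for j l'
    proof -
      have "L j ! l' \<in> set (L j)"
        using L(1)[OF that(1)] that(2) by simp
      then show ?thesis
        using V[OF that(1)] by (auto simp: L_def)
    qed
    have not_L: "M i ! l \<noteq> L j ! l'" if "j \<in> K" "l' < 2 * d + 3" for j l'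
      using in_L[OF that] newV[OF that(1)] newP[OF that(1)] by auto
    show ?thesis
    proof (rule edge_cases[OF w])
      assume "{w, M i ! l} \<in> edges T'"
      then show ?thesis
        using edge_sub newV[OF iK] by blast
    next
      fix j l'
      assume "j \<in> K" "l' < 2 * d + 2" "{w, M i ! l} = {L j ! l', L j ! Suc l'}"
      then show ?thesis
        using not_L[of j l'] not_L[of j "Suc l'"] unfolding doubleton_eq_iff by simp
    next
      fix j
      assume "j \<in> K" "{w, M i ! l} = {x j, L j ! Suc d}"
      moreover have "M i ! l \<noteq> x j"
        using newV[OF \<open>j \<in> K\<close>] V(1)[OF \<open>j \<in> K\<close>] by metis
      ultimately show ?thesis
        using not_L[of j "Suc d"] unfolding doubleton_eq_iff by simp
    next
      fix j l'
      assume j: "j \<in> I" "l' < Suc d" "{w, M i ! l} = {M j ! l', M j ! Suc l'}"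
      then consider "M i ! l = M j ! l'" "w = M j ! Suc l'" | "M i ! l = M j ! Suc l'" "w = M j ! l'"
        unfolding doubleton_eq_iff by metis
      then show ?thesis
      proof cases
        case 1
        then have "j = i \<and> l' = l"
          using own[OF j(1) 1(1)] j(2) by simp
        then show ?thesis
          using 1(2) by simp
      next
        case 2
        then have "j = i \<and> Suc l' = l"
          using own[OF j(1) 2(1)] j(2) by simp
        then show ?thesis
          using 2(2) by auto
      qed
    qed
  qed
  \<comment> \<open>Each new edge has a new endpoint, so \<open>T\<close> gains no edge between old
    vertices.\<close>
  have old: "e \<in> edges T'" if "e \<in> edges T" "e \<subseteq> verts T'" for e
  proof (rule edge_cases[OF that(1)])
    fix j l
    assume j: "j \<in> K" "l < 2 * d + 2" "e = {L j ! l, L j ! Suc l}"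
    \<comment> \<open>Index \<open>0\<close> of \<open>L j\<close> is the old vertex
      \<open>xm j\<close>, so there the other endpoint is taken.\<close>
    have "L j ! (if l = 0 then Suc l else l) \<in> set (P j)"
      using j L_in[OF j(1)] by auto
    then show ?thesis
      using j that(2) P[OF j(1)] by (auto split: if_splits)
  next
    fix j
    assume j: "j \<in> K" "e = {x j, L j ! Suc d}"
    then show ?thesis
      using L_in[OF j(1), of "Suc d"] that(2) P[OF j(1)] by auto
  next
    fix j l
    assume j: "j \<in> I" "l < Suc d" "e = {M j ! l, M j ! Suc l}"
    have "M j ! (if l = 0 then Suc l else l) \<in> set (Q j)"
      using j M_in[OF j(1)] d by auto
    then show ?thesis
      using j that(2) Q[OF j(1)] by (auto split: if_splits)
  qed
  \<comment> \<open>The corner property has to be extended to \<open>T\<close>, where a new vertex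
    might be a second common neighbour.\<close>
  have common: "w = x i"
    if i: "i \<in> K" and w: "w \<in> S" "{w, xm i} \<in> edges T" "{w, xp i} \<in> edges T" for i w
  proof -
    consider "w \<in> verts T'" | j where "j \<in> K" "w \<in> set (P j)" | j where "j \<in> I" "w \<in> set (Q j)"
      using w(1) S unfolding T by auto
    then show ?thesis
    proof cases
      case 1
      then have "{w, xm i} \<in> edges T'" "{w, xp i} \<in> edges T'"
        using old w V[OF i] by auto
      then show ?thesis
        using corner_common[OF xB[OF i], of "xm i" "xp i" w] nbrs[OF i] by blast
    next
      case 2
      then obtain l where l: "l < 2 * d + 1" "w = P j ! l"
        using P[OF 2(1)] by (metis in_set_conv_nth)
      then have wL: "w = L j ! Suc l"
        using L(5)[OF 2(1)] by simp
      \<comment> \<open>A vertex of \<open>P j\<close> has an old neighbour only at the two ends and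
        in the middle, one each, so it cannot be adjacent to both \<open>xm i\<close> and
        \<open>xp i\<close>.\<close>
      have attach: "l = 0 \<and> u = xm j \<or> l = 2 * d \<and> u = xp j \<or> l = d \<and> u = x j"
        if "{w, u} \<in> edges T" "u \<in> verts T'" for u
      proof -
        have "{u, L j ! Suc l} \<in> edges T"
          using that(1) wL by (simp add: insert_commute)
        then have "u = L j ! l \<or> u = L j ! Suc (Suc l) \<or> l = d \<and> u = x j \<or> j \<in> I \<and> u \<in> set (Q j)"
          using nbrP[OF 2(1), of "Suc l" u] l(1) Q[of j] d
            hd_in_set[of "Q j"] last_in_set[of "Q j"] by fastforce
        moreover have "u \<notin> set (Q j)" if "j \<in> I"
          using Q[OF that] \<open>u \<in> verts T'\<close> by blast
        moreover have "l = 0" if "u = L j ! l"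
          using L_in[OF 2(1), of l] P[OF 2(1)] that \<open>u \<in> verts T'\<close> l(1) by (cases "l = 0") auto
        moreover have "l = 2 * d" if "u = L j ! Suc (Suc l)"
          using L_in[OF 2(1), of "Suc (Suc l)"] P[OF 2(1)] that \<open>u \<in> verts T'\<close> l(1)
          by (cases "l = 2 * d") auto
        ultimately show ?thesis
          using L(3,4)[OF 2(1)] by auto
      qed
      show ?thesis
        using attach[OF w(2)] attach[OF w(3)] V[OF i] nbrs[OF i] d by auto
    next
      case 3
      then obtain l where l: "l < d" "w = Q j ! l"
        using Q[OF 3(1)] by (metis in_set_conv_nth)
      then have "w = M j ! Suc l"
        using M(6)[OF 3(1)] by simp
      then have "{xm i, M j ! Suc l} \<in> edges T"
        using w(2) by (simp add: insert_commute)
      \<comment> \<open>Neighbours of a vertex of \<open>Q j\<close> lie on \<open>M j\<close>,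
        which consists of new vertices.\<close>
      then have "xm i = M j ! l \<or> xm i = M j ! Suc (Suc l)"
        using nbrQ[OF 3(1), of "Suc l" "xm i"] l(1) by simp
      then have "xm i \<in> set (M j)"
        using M(1)[OF 3(1)] l(1) by auto
      moreover have "j \<in> K"
        using 3(1) I by auto
      ultimately have "xm i \<in> set (P j) \<or> xm i \<in> set (Q j)"
        using P[of j] d by (auto simp: M_def)
      then show ?thesis
        using V(2)[OF i] P[OF \<open>j \<in> K\<close>] Q[OF 3(1)] by blast
    qed
  qed
  have walk_path: "walk xs" if "path_edges xs \<subseteq> edges T" for xs
    using that by (auto simp: successively_conv_nth path_edges_def)
  have avoid: "S \<inter> set (P i) = {} \<and> (i \<in> I \<longrightarrow> S \<inter> set (Q i) = {})" if i: "i \<in> K" for i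
  proof -
    have nV: "v \<notin> verts T' \<or> v \<notin> set (P i)" "i \<in> I \<Longrightarrow> v \<notin> verts T' \<or> v \<notin> set (Q i)" for v
      using P[OF i] Q[of i] by auto
    note facts = piece_avoided[OF d(1) card_d, of "P i" "i \<in> I" "Q i" "xm i" "xp i" "x i",
        folded L_def M_def]
    have no_loop': "x i \<noteq> xm i" "x i \<noteq> xp i"
    proof -
      have "card {v, v} \<noteq> 2" for v :: 'a
        by simp
      then have "{v, v} \<notin> edges T'" for v
        using terr unfolding territory_def simple_graph_def by blast
      then show "x i \<noteq> xm i" "x i \<noteq> xp i"
        using x_edges[OF i] by metis+
    qed
    have e: "{xm i, x i} \<in> edges T" "{xp i, x i} \<in> edges T" "{x i, P i ! d} \<in> edges T"
      using x_edges[OF i] i unfolding E by auto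
    have ne: "{xm i, xp i} \<notin> edges T"
      using old[of "{xm i, xp i}"] V[OF i] corner[OF xB[OF i], of "xm i" "xp i"] nbrs[OF i] by auto
    have wL: "walk (L i)"
      using i by (intro walk_path) (auto simp: E)
    have wM: "walk (M i)" if "i \<in> I"
      using that by (intro walk_path) (auto simp: E)
    show ?thesis
    proof (intro conjI impI)
      show "S \<inter> set (P i) = {}"
        by (rule facts(1))
          (use P[OF i] Q[of i] PQ[OF i, of i] V[OF i] nV nbrs[OF i] no_loop' e ne wL wM nbrP[OF i] nbrQ common[OF i] in blast)+
      show "S \<inter> set (Q i) = {}" if "i \<in> I"
        by (rule facts(2))
          (use P[OF i] Q[of i] PQ[OF i, of i] V[OF i] nV nbrs[OF i] no_loop' e ne wL wM nbrP[OF i] nbrQ common[OF i] that in blast)+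
    qed
  qed
  show SV: "S \<subseteq> verts T'"
  proof
    fix v
    assume "v \<in> S"
    moreover have "v \<in> verts T' \<or> (\<exists>i\<in>K. v \<in> set (P i)) \<or> (\<exists>i\<in>I. v \<in> set (Q i))"
      using \<open>v \<in> S\<close> S unfolding T by auto
    ultimately show "v \<in> verts T'"
      using avoid I by blast
  qed
  have "{u, v} \<in> edges T \<longleftrightarrow> {u, v} \<in> edges T'" if "u \<in> S" "v \<in> S" for u v
    using old[of "{u, v}"] SV that E by blast
  then show "induced_cycle (edges T') S"
    by (rule induced_cycle_cong[OF cyc])
qed

section \<open>Corners of the base cycles and the conclusion\<close>

text \<open>With \<open>v\<close> at index \<open>Suc k\<close>, its two cycle neighbours are at
  \<open>k\<close> and \<open>k + 2\<close>, so the facts on vertices two apart supply the corner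
  hypotheses of \<open>expansion_avoids\<close>.\<close>

lemma base_cycle_corner:
  assumes t: "5 \<le> t" and v: "v \<in> verts (base_cycle t m)"
    and nbrs: "neighbours (base_cycle t m) v = {a, b}" and "a \<noteq> b"
  shows "{a, b} \<notin> edges (base_graph t m)"
    and "{w, a} \<in> edges (base_graph t m) \<Longrightarrow> {w, b} \<in> edges (base_graph t m) \<Longrightarrow> w = v"
proof -
  let ?A = "level_vertex t m"
  obtain k' where "v = ?A k'"
    using v unfolding verts_base_cycle[OF t] by blast
  \<comment> \<open>Adding a full turn before stepping back keeps the predecessor index positive
    even when \<open>k'\<close> is \<open>0\<close>.\<close>
  define k where "k = k' + level_size t m - 1"
  have "0 < k" "Suc k = k' + level_size t m"
    using level_size_ge[OF t, of m] by (auto simp: k_def)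
  then have k: "v = ?A (Suc k)"
    using \<open>v = ?A k'\<close> by (simp add: level_vertex_def)
  have "u = ?A k \<or> u = ?A (k + 2)" if "u \<in> {a, b}" for u
  proof -
    have "{u, ?A (Suc k)} \<in> edges (base_cycle t m)"
      using that nbrs k by (auto simp: neighbours_def)
    then obtain j where "{u, ?A (Suc k)} = {?A j, ?A (Suc j)}"
      unfolding edges_base_cycle[OF t] by blast
    then consider "u = ?A j" "?A (Suc k) = ?A (Suc j)" | "u = ?A (Suc j)" "?A (Suc k) = ?A j"
      by (auto simp: doubleton_eq_iff)
    then show ?thesis
      by cases (use level_vertex_Suc_iff[of t m k j] level_vertex_Suc_iff[of t m "Suc k" j] in auto)
  qed
  then have ab: "a = ?A k \<and> b = ?A (k + 2) \<or> a = ?A (k + 2) \<and> b = ?A k"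
    using \<open>a \<noteq> b\<close> by blast
  then show "{a, b} \<notin> edges (base_graph t m)"
    using level_vertex_not_adjacent[OF t \<open>0 < k\<close>, of m m] by (auto simp: insert_commute)
  show "w = v" if "{w, a} \<in> edges (base_graph t m)" "{w, b} \<in> edges (base_graph t m)"
    using ab level_vertex_common_neighbour[OF t \<open>0 < k\<close>, of w m m] that k by auto
qed

theorem theorem3p2:
  fixes t :: nat and T B :: "'a sgraph"
  assumes "t \<ge> 5"
    and "canonical t T B"
  shows "induced_free (cycle_graph (2 * t - 2)) T"
proof -
  obtain m and T' B' :: "(nat \<times> nat) sgraph" and f where
    exp: "expansion t (base_graph t m) (base_cycle t m) T' B'" and f: "isomorphism f T T'"
    using assms(2) unfolding canonical_def by blast
  have "\<not> isomorphism g (induce T' S) (cycle_graph (2 * t - 2))" if "S \<subseteq> verts T'" for S g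
  proof
    assume g: "isomorphism g (induce T' S) (cycle_graph (2 * t - 2))"
    have verts: "verts (cycle_graph (2 * t - 2)) = {..<2 * t - 2}"
      by (auto simp: cycle_graph_def cycle_of_def)
    have "induced_cycle (edges (cycle_graph (2 * t - 2))) (verts (cycle_graph (2 * t - 2)))"
      unfolding verts using assms(1) by (intro induced_cycle_cycle_graph) simp
    from isomorphism_induced_cycle[OF g this]
    have S: "induced_cycle (edges T') S" "card S = 2 * t - 2"
      by (simp_all add: verts)
    note base = expansion_avoids[OF assms(1) exp S(1) that S(2) base_cycle_corner[OF assms(1)]]
    have "induced_cycle (edges (base_graph t m)) S" "S \<subseteq> verts (base_graph t m)"
      by (rule base; assumption)+
    then show False
      using base_graph_no_cycle[OF assms(1)] S(2) by blast
  qed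
  then have "induced_free (cycle_graph (2 * t - 2)) T'"
    unfolding induced_free_def by blast
  then show ?thesis
    by (rule isomorphism_induced_free[OF f])
qed

end
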